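(* Let $L=0.022$, $\ell=0.011$, $r_W=\ell+\tfrac34(L-\ell)$ (metres), $\alpha_Y=1.3\times10^{-7}$, $\alpha_W=1.7\times10^{-7}$ (m$^2$/s), $\kappa_Y=0.34$, $\kappa_W=0.52$ (W/(m K)), $h=1000$ (W/(m$^2$ K)), and $T_0=20$, $T_Y^*=65$, $T_W^*=85$, $T_{\mathrm{ice}}=1$ (degrees Celsius). For $0\le t_1<t_2$ let $T_w(t)=T_Y^*$ for $0\le t<t_1$, $T_w(t)=100$ for $t_1\le t<t_2$, and $T_w(t)=T_{\mathrm{ice}}$ for $t\ge t_2$, and let $(u_Y,u_W)$ be the corresponding solution of the two-domain spherical heat problem given in the context. Then there exists $t_1>0$ such that $\Upsilon(t_1)=T_Y^*$ exactly, with the corresponding $t_2=t_2(t_1)$ and $T^*$ (the time at which the peak of $u_Y(\cdot,0)$ occurs) satisfying the no-overshoot constraints. Explicitly: there exist $t_1>0$, $t_2>t_1$ and $T^*\ge t_2$ such that, for the solution $(u_Y,u_W)$ associated with this $(t_1,t_2)$, (i) $\max_{t\ge t_2}u_W(t,r_W)=T_W^*$ (that is, $t_2=t_2(t_1)$); (ii) $\max_{t\ge t_2}u_Y(t,0)=u_Y(T^*,0)=T_Y^*$ (that is, $\Upsilon(t_1)=T_Y^*$, the peak being attained at $T^*$); (iii) $u_Y(t,0)\le T_Y^*$ for all $t\in[0,T^*]$, and $u_Y(T^*,0)=T_Y^*$; (iv) $u_W(t,r_W)\le T_W^*$ for all $t\in[0,T^*]$ (in particular $u_W(T^*,r_W)\le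 T_W^*$).
   Context: Model. A sphere of radius $L$ consists of an inner ball (yolk) $0\le r<\ell$ and an outer shell (albumen) $\ell<r<L$. For a given piecewise-constant bath temperature $T_w:[0,\infty)\to\mathbb{R}$, the temperatures $u_Y(t,r)$ (for $0\le r\le\ell$) and $u_W(t,r)$ (for $\ell\le r\le L$) are the spherically symmetric solution of $$\partial_t u_Y=\frac{\alpha_Y}{r^2}\partial_r\bigl(r^2\partial_r u_Y\bigr),\quad 0<r<\ell,\ t>0,\qquad \partial_t u_W=\frac{\alpha_W}{r^2}\partial_r\bigl(r^2\partial_r u_W\bigr),\quad \ell<r<L,\ t>0,$$ with initial condition $u_Y(0,r)=u_W(0,r)=T_0$, regularity at the centre $|u_Y(t,0)|<\infty$, interface conditions $$u_Y(t,\ell)=u_W(t,\ell),\qquad \kappa_Y\,\partial_r u_Y(t,\ell)=\kappa_W\,\partial_r u_W(t,\ell),$$ and the outer Robin condition $$-\kappa_W\,\partial_r u_W(t,L)=h\bigl[u_W(t,L)-T_w(t)\bigr].$$ The solution is understood in the usual sense for piecewise-constant $T_w$: it is continuous in $(t,r)$, and the Robin condition holds at times $t>0$ other than the switching times of $T_w$. Time is in seconds and temperature in degrees Celsius. Notation. For fixed $t_1$, $t_2(t_1)$ denotes the end time $t_2>t_1$ of the $100$-degree phase such that the subsequent peak of $u_W(\cdot,r_W)$, i.e. its maximum over times from $t_2$ onwards (with the bath kept at $T_{\mathrm{ice}}$ for all $t\ge t_2$), equals $T_W^*$ exactly. With $t_1$ and $t_2=t_2(t_1)$ fixed, $\Upsilon(t_1)$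 denotes the resulting peak (maximum) value of $u_Y(\cdot,0)$ over times from $t_2$ onwards, and $T^*$ is the time at which that peak occurs. *)

theory Defs
  imports "HOL-Analysis.Analysis"
begin

text \<open>Functions \<open>u t r\<close> take the time first and the radius second.\<close>

text \<open>The equation \<open>u\<^sub>t = (\<alpha> / r\<^sup>2) (r\<^sup>2 u\<^sub>r)\<^sub>r\<close> for \<open>a < r < b\<close> and
  \<open>t > 0\<close>; \<open>v\<close> is \<open>u\<^sub>r\<close> and \<open>D\<close> is \<open>(r\<^sup>2 u\<^sub>r)\<^sub>r\<close>.\<close>

definition radial_heat_eq :: "real \<Rightarrow> real \<Rightarrow> real \<Rightarrow> (real \<Rightarrow> real \<Rightarrow> real) \<Rightarrow> bool" where
  "radial_heat_eq \<alpha> a b u \<longleftrightarrow>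
    (\<exists>v. \<forall>t>0. \<forall>r\<in>{a<..<b}.
      ((\<lambda>x. u t x) has_real_derivative v t r) (at r) \<and>
      (\<exists>D. ((\<lambda>x. x\<^sup>2 * v t x) has_real_derivative D) (at r) \<and>
           ((\<lambda>s. u s r) has_real_derivative \<alpha> / r\<^sup>2 * D) (at t)))"

text \<open>\<open>S\<close> is the set of switching times of the bath temperature \<open>Tw\<close>. The derivatives at
  \<open>r = l\<close> and \<open>r = L\<close> are one-sided. Boundedness of \<open>uY\<close> at the centre is
  contained in its continuity up to \<open>r = 0\<close>.\<close>

definition egg_solution ::
  "real \<Rightarrow> real \<Rightarrow> real \<Rightarrow> real \<Rightarrow> real \<Rightarrow> real \<Rightarrow> real \<Rightarrow> real \<Rightarrow> (real \<Rightarrow> real) \<Rightarrow> real set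
    \<Rightarrow> (real \<Rightarrow> real \<Rightarrow> real) \<Rightarrow> (real \<Rightarrow> real \<Rightarrow> real) \<Rightarrow> bool" where
  "egg_solution l L \<alpha>Y \<alpha>W \<kappa>Y \<kappa>W h T0 Tw S uY uW \<longleftrightarrow>
     continuous_on ({0..} \<times> {0..l}) (\<lambda>(t, r). uY t r) \<and>
     continuous_on ({0..} \<times> {l..L}) (\<lambda>(t, r). uW t r) \<and>
     radial_heat_eq \<alpha>Y 0 l uY \<and>
     radial_heat_eq \<alpha>W l L uW \<and>
     (\<forall>r\<in>{0..l}. uY 0 r = T0) \<and>
     (\<forall>r\<in>{l..L}. uW 0 r = T0) \<and>
     (\<forall>t>0. uY t l = uW t l) \<and>
     (\<forall>t>0. \<exists>DY DW. (uY t has_real_derivative DY) (at l within {0..l}) \<and>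
                    (uW t has_real_derivative DW) (at l within {l..L}) \<and>
                    \<kappa>Y * DY = \<kappa>W * DW) \<and>
     (\<forall>t>0. t \<notin> S \<longrightarrow>
        (\<exists>D. (uW t has_real_derivative D) (at L within {l..L}) \<and>
             - \<kappa>W * D = h * (uW t L - Tw t)))"

definition bath :: "real \<Rightarrow> real \<Rightarrow> real \<Rightarrow> real \<Rightarrow> real \<Rightarrow> real" where
  "bath TY Tice t1 t2 t = (if t < t1 then TY else if t < t2 then 100 else Tice)"

end

theory Submission
  imports Defs
begin

text \<open>Length and time are measured in units of 11 mm and 121 s. Every estimate is a comparison with an
  explicit barrier. A maximum principle gives uniqueness, monotonicity in time during the heating, and
  continuity and monotonicity of the two peak temperatures \<open>W\<close> (white) and \<open>Y\<close> (centre) in the lengths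
  \<open>t1\<close> and \<open>d\<close> of the first two phases. Monotonicity in time gives the no-overshoot constraints, and
  monotonicity of the peaks reduces \<open>W = 85\<close>, \<open>Y = 65\<close> to two opposite corners of a rectangle of
  parameters, by Brouwer's fixed point theorem. In one corner \<open>t1\<close> is large and \<open>d\<close> tiny: the white
  barely heats up, while the centre, already almost at 65, is lifted above it. In the other corner
  \<open>t1 = 0\<close>, and \<open>W \<ge> 85\<close>, \<open>Y < 65\<close> follow from barriers with rational coefficients, which were found
  by linear programming.\<close>

section \<open>Subsolutions and the maximum principle\<close>

text \<open>The unit 121 s is (11 mm)^2 divided by 10^-6 m^2/s; the diffusivities become 13/100 and
  17/100, and barriers with integer coefficients can be checked by exact arithmetic. Hitting both
  targets at once avoids the function \<open>t2(t1)\<close>: only continuity and weak monotonicity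
  of the peaks are required, no strictness. Continuity survives the supremum over an unbounded time
  range because two solutions with the same bath never move apart in the sup norm. The corner
  \<open>t1 = 0\<close>, \<open>d = 21 / 10\<close> is the delicate one: the bounds leave about 0.2
  degrees for the white and 0.1 for the centre. The white is judged at the end of the boiling, but
  the centre peaks later, when two transients of opposite sign overlap. Each is bounded on its own
  side, and their rates 2/5 and 21/50 enclose the slowest decay rate of the egg. The other corner
  needs no accuracy: any positive gain at the centre suffices, since \<open>t1\<close> may be as
  large as the gain demands.\<close>

definition diffusivity :: "real \<Rightarrow> real" where
  "diffusivity r = (if r < 1 then 13 / 100 else 17 / 100)"

text \<open>Subsolutions for bath temperature 0. The constants are those of the problem: \<open>17 : 26\<close> is the ratio of
  the conductivities 0.34 and 0.52, and \<open>26 : 550\<close> that of 0.52 and \<open>h\<close> times the unit of length.\<close>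

definition subsol :: "real \<Rightarrow> real \<Rightarrow> (real \<Rightarrow> real \<Rightarrow> real) \<Rightarrow> bool" where
  "subsol a b f \<longleftrightarrow>
     continuous_on ({a..b} \<times> {0..2}) (\<lambda>(t, r). f t r) \<and>
     (\<forall>t\<in>{a<..<b}.
        (\<exists>v. \<forall>r\<in>{0<..<2} - {1}. (f t has_real_derivative v r) (at r) \<and>
           (\<exists>D E. ((\<lambda>x. x\<^sup>2 * v x) has_real_derivative D) (at r) \<and>
                  ((\<lambda>s. f s r) has_real_derivative E) (at t) \<and>
                  E \<le> diffusivity r / r\<^sup>2 * D)) \<and>
        (\<exists>DY DW. (f t has_real_derivative DY) (at 1 within {0..1}) \<and>
                 (f t has_real_derivative DW) (at 1 within {1..2}) \<and> 17 * DY \<le> 26 * DW) \<and>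
        (\<exists>D. (f t has_real_derivative D) (at 2 within {1..2}) \<and> 26 * D + 550 * f t 2 \<le> 0))"

lemma diffusivity_pos: "diffusivity r > 0"
  by (simp add: diffusivity_def)

lemma max_right_deriv_nonneg:
  fixes f :: "real \<Rightarrow> real"
  assumes "(f has_real_derivative D) (at x within {c..x})" "c < x"
    and "\<And>y. y \<in> {c..x} \<Longrightarrow> f y \<le> f x"
  shows "D \<ge> 0"
proof (rule ccontr)
  assume "\<not> D \<ge> 0"
  then obtain d where d: "d > 0" "\<And>h. h > 0 \<Longrightarrow> x - h \<in> {c..x} \<Longrightarrow> h < d \<Longrightarrow> f x < f (x - h)"
    using has_real_derivative_neg_dec_left[OF assms(1)] by auto
  define h where "h = min (d / 2) (x - c)"
  have "h > 0" "h < d" "x - h \<in> {c..x}" using d(1) assms(2) by (auto simp: h_def)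
  then show False using d(2)[of h] assms(3)[of "x - h"] by auto
qed

lemma max_left_deriv_nonpos:
  fixes f :: "real \<Rightarrow> real"
  assumes "(f has_real_derivative D) (at x within {x..c})" "x < c"
    and "\<And>y. y \<in> {x..c} \<Longrightarrow> f y \<le> f x"
  shows "D \<le> 0"
proof (rule ccontr)
  assume "\<not> D \<le> 0"
  then obtain d where d: "d > 0" "\<And>h. h > 0 \<Longrightarrow> x + h \<in> {x..c} \<Longrightarrow> h < d \<Longrightarrow> f x < f (x + h)"
    using has_real_derivative_pos_inc_right[OF assms(1)] by auto
  define h where "h = min (d / 2) (c - x)"
  have "h > 0" "h < d" "x + h \<in> {x..c}" using d(1) assms(2) by (auto simp: h_def)
  then show False using d(2)[of h] assms(3)[of "x + h"] by auto
qed

text \<open>At the maximum the flux \<open>x\<^sup>2 * V x\<close> vanishes, so a positive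
  derivative would make it, and hence \<open>V\<close>, positive just to the right, where
  \<open>g\<close> would then increase.\<close>

lemma max_radial_laplacian_nonpos:
  fixes g V :: "real \<Rightarrow> real"
  assumes "c < r" "r < d" "0 \<le> c"
    and g: "\<And>x. x \<in> {c<..<d} \<Longrightarrow> (g has_real_derivative V x) (at x)"
    and V: "((\<lambda>x. x\<^sup>2 * V x) has_real_derivative D) (at r)"
    and max: "\<And>x. x \<in> {c<..<d} \<Longrightarrow> g x \<le> g r"
  shows "D \<le> 0"
proof -
  have V0: "V r = 0"
  proof (rule DERIV_local_max[OF g[of r]])
    show "r \<in> {c<..<d}" using assms by simp
    show "0 < min (r - c) (d - r)" using assms by simp
    show "\<forall>y. \<bar>r - y\<bar> < min (r - c) (d - r) \<longrightarrow> g y \<le> g r"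
      using max by (auto simp: abs_if split: if_splits)
  qed
  show "D \<le> 0"
  proof (rule ccontr)
    assume "\<not> D \<le> 0"
    then obtain e where e: "e > 0" "\<And>h. h > 0 \<Longrightarrow> h < e \<Longrightarrow> r\<^sup>2 * V r < (r + h)\<^sup>2 * V (r + h)"
      using DERIV_pos_inc_right[OF V] by auto
    define h where "h = min (e / 2) ((d - r) / 2)"
    have "h \<le> e / 2" "h \<le> (d - r) / 2" unfolding h_def by (rule min.cobounded1, rule min.cobounded2)
    moreover have "h > 0" using e(1) assms(2) by (simp add: h_def)
    moreover have "(d - r) / 2 < d - r" "e / 2 < e" using e(1) assms(2) by simp_all
    ultimately have h: "h > 0" "h < e" "r + h < d" using e(1) assms(2) by linarith+
    have "\<exists>z>r. z < r + h \<and> g (r + h) - g r = (r + h - r) * V z"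
      by (rule MVT2) (use g h assms in auto)
    then obtain z where z: "z > r" "z < r + h" "g (r + h) - g r = h * V z" by auto
    have "0 < z\<^sup>2 * V z" using e(2)[of "z - r"] z h V0 by auto
    then have "V z > 0" by (simp add: zero_less_mult_iff)
    then have "g (r + h) > g r" using z h by (smt (verit) mult_pos_pos)
    moreover have "r + h \<in> {c<..<d}" using h assms(1) by auto
    ultimately show False using max[of "r + h"] by linarith
  qed
qed

text \<open>The term \<open>1 / r\<close> is harmonic and infinite at the centre, which therefore needs no boundary condition.
  Since \<open>17 < 26\<close>, subtracting a multiple of it also makes the interface inequality strict.\<close>

lemma maximum_principle_interior:
  assumes f: "subsol a b f" and init: "\<And>r. r \<in> {0..2} \<Longrightarrow> f a r \<le> 0"
    and T: "a \<le> T" "T < b" and R: "0 < R" "R \<le> 2" and \<eta>: "\<eta> > 0"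
  shows "f T R \<le> \<eta> * (1 / R + (T - a))"
proof (rule ccontr)
  assume neg: "\<not> f T R \<le> \<eta> * (1 / R + (T - a))"
  define g where "g t r = f t r - \<eta> * (1 / r + (t - a))" for t r
  have cf: "continuous_on ({a..b} \<times> {0..2}) (\<lambda>(t, r). f t r)"
    using f by (simp add: subsol_def)
  have "compact ((\<lambda>(t, r). f t r) ` ({a..b} \<times> {0..2}))"
    by (rule compact_continuous_image[OF cf]) (intro compact_Times compact_Icc)
  then obtain M0 where M0: "\<And>t r. t \<in> {a..b} \<Longrightarrow> r \<in> {0..2} \<Longrightarrow> \<bar>f t r\<bar> \<le> M0"
    unfolding compact_eq_bounded_closed bounded_iff by force
  define M where "M = \<bar>M0\<bar> + 1"
  have M: "M > 0" "\<And>t r. t \<in> {a..b} \<Longrightarrow> r \<in> {0..2} \<Longrightarrow> f t r \<le> M"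
    using M0 by (fastforce simp: M_def)+
  \<comment> \<open>At radius \<rho> the singular term \<eta>/\<rho> is at least the bound
    \<open>M\<close> on \<open>f\<close>. Cutting off there gives a compact domain whose inner edge
    cannot carry a positive maximum.\<close>
  define \<rho> where "\<rho> = min (1 / 2) (min R (\<eta> / M))"
  have "0 < \<eta> / M" using \<eta> M(1) by simp
  then have \<rho>: "0 < \<rho>" "\<rho> \<le> 1 / 2" "\<rho> \<le> R" "\<rho> \<le> \<eta> / M"
    using R(1) unfolding \<rho>_def by linarith+
  have g\<rho>: "g t \<rho> \<le> 0" if "t \<in> {a..T}" for t
  proof -
    have "M * \<rho> \<le> \<eta>" using \<rho>(4) M by (simp add: field_simps)
    then have "M \<le> \<eta> / \<rho>" using \<rho>(1) by (simp add: field_simps)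
    moreover have "f t \<rho> \<le> M" using M(2) that T \<rho> by auto
    moreover have "0 \<le> \<eta> * (t - a)" using \<eta> that by auto
    ultimately show ?thesis by (simp add: g_def algebra_simps)
  qed
  have cg: "continuous_on ({a..T} \<times> {\<rho>..2}) (\<lambda>(t, r). g t r)"
  proof -
    have "continuous_on ({a..T} \<times> {\<rho>..2}) (\<lambda>p. (\<lambda>(t, r). f t r) p - \<eta> * (1 / snd p + (fst p - a)))"
      by (intro continuous_intros continuous_on_subset[OF cf]) (use T \<rho> in auto)
    then show ?thesis by (simp add: g_def case_prod_beta)
  qed
  have "\<exists>p\<in>{a..T} \<times> {\<rho>..2}. \<forall>y\<in>{a..T} \<times> {\<rho>..2}. (\<lambda>(t, r). g t r) y \<le> (\<lambda>(t, r). g t r) p"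
    by (rule continuous_attains_sup[OF _ _ cg]) (use T R \<rho> in \<open>auto intro!: compact_Times\<close>)
  then obtain t r where tr: "t \<in> {a..T}" "r \<in> {\<rho>..2}"
    and max: "\<And>t' r'. t' \<in> {a..T} \<Longrightarrow> r' \<in> {\<rho>..2} \<Longrightarrow> g t' r' \<le> g t r"
    by fastforce
  have "g T R > 0" using neg by (simp add: g_def)
  then have gpos: "g t r > 0" using max[of T R] T R \<rho> by auto
  have "t \<noteq> a"
  proof
    assume "t = a"
    moreover have "0 < \<eta> * (1 / r)" using \<eta> tr \<rho> by auto
    ultimately show False using gpos init[of r] tr \<rho> by (auto simp: g_def)
  qed
  then have t: "a < t" "t \<le> T" "t \<in> {a<..<b}" using tr T by auto
  have "r \<noteq> \<rho>" using g\<rho>[of t] gpos tr by auto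
  then have r: "\<rho> < r" "r \<le> 2" "0 < r" using tr \<rho> by auto
  have dg: "(g t has_real_derivative D + \<eta> / x\<^sup>2) (at x within S)"
    if "(f t has_real_derivative D) (at x within S)" "x > 0" for D x S
    unfolding g_def using that(2)
    by (auto intro!: derivative_eq_intros that(1) simp: power2_eq_square)
  consider "r = 2" | "r = 1" | "r \<in> {0<..<2} - {1}" using r by fastforce
  then show False
  proof cases
    case 1
    from f t(3) obtain D where D: "(f t has_real_derivative D) (at 2 within {1..2})" "26 * D + 550 * f t 2 \<le> 0"
      unfolding subsol_def by blast
    have "D + \<eta> / 2\<^sup>2 \<ge> 0"
      by (rule max_right_deriv_nonneg[OF dg[OF D(1)]]) (use max[of t] 1 tr \<rho> in auto)
    then have "D + \<eta> / 4 \<ge> 0" by simp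
    moreover have "f t 2 > \<eta> / 2 + \<eta> * (t - a)" using gpos 1 by (simp add: g_def distrib_left)
    moreover have "0 \<le> \<eta> * (t - a)" using \<eta> t by auto
    ultimately show False using D(2) \<eta> by linarith
  next
    case 2
    from f t(3) obtain DY DW where D: "(f t has_real_derivative DY) (at 1 within {0..1})"
        "(f t has_real_derivative DW) (at 1 within {1..2})" "17 * DY \<le> 26 * DW"
      unfolding subsol_def by blast
    have "DY + \<eta> / 1\<^sup>2 \<ge> 0"
      by (rule max_right_deriv_nonneg[OF dg[OF has_field_derivative_subset[OF D(1)]], of \<rho>])
        (use max[of t] 2 tr \<rho> in auto)
    moreover have "DW + \<eta> / 1\<^sup>2 \<le> 0"
      by (rule max_left_deriv_nonpos[OF dg[OF D(2)]]) (use max[of t] 2 tr \<rho> in auto)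
    ultimately show False using D(3) \<eta> by simp
  next
    case 3
    from f t(3) obtain v where v: "\<And>x. x \<in> {0<..<2} - {1} \<Longrightarrow> (f t has_real_derivative v x) (at x)"
      and vD: "\<And>x. x \<in> {0<..<2} - {1} \<Longrightarrow> \<exists>D E. ((\<lambda>x. x\<^sup>2 * v x) has_real_derivative D) (at x) \<and>
                  ((\<lambda>s. f s x) has_real_derivative E) (at t) \<and> E \<le> diffusivity x / x\<^sup>2 * D"
      unfolding subsol_def by blast
    from vD[OF 3] obtain D E where D: "((\<lambda>x. x\<^sup>2 * v x) has_real_derivative D) (at r)"
      and E: "((\<lambda>s. f s r) has_real_derivative E) (at t)" "E \<le> diffusivity r / r\<^sup>2 * D"
      by blast
    define c d where "c = (if r < 1 then \<rho> else 1)" and "d = (if r < 1 then 1 else 2 :: real)"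
    have cd: "c < r" "r < d" "0 \<le> c" "{c<..<d} \<subseteq> ({0<..<2} - {1}) \<inter> {\<rho>..2}"
      using 3 r \<rho> by (auto simp: c_def d_def)
    have "((\<lambda>x. x\<^sup>2 * v x + \<eta>) has_real_derivative D) (at r)"
      using DERIV_add[OF D DERIV_const[of \<eta>]] by simp
    then have "((\<lambda>x. x\<^sup>2 * (v x + \<eta> / x\<^sup>2)) has_real_derivative D) (at r)"
      by (rule has_field_derivative_transform_within_open[of _ _ _ "{0<..}"])
        (use r in \<open>auto simp: algebra_simps\<close>)
    then have "D \<le> 0"
    proof (rule max_radial_laplacian_nonpos[OF cd(1,2,3), rotated])
      show "(g t has_real_derivative v x + \<eta> / x\<^sup>2) (at x)" if "x \<in> {c<..<d}" for x
        using that cd by (intro dg v) auto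
      show "g t x \<le> g t r" if "x \<in> {c<..<d}" for x using max[of t x] tr cd that by auto
    qed
    then have "E \<le> 0" using E(2) diffusivity_pos[of r] r
      by (smt (verit) divide_nonneg_nonneg mult_nonneg_nonpos zero_le_power2)
    \<comment> \<open>The maximum may sit at the last time \<open>T\<close>, so only the derivative
      from the left has a sign.\<close>
    have "((\<lambda>s. g s r) has_real_derivative E - \<eta>) (at t within {a..t})"
      unfolding g_def
      by (rule has_field_derivative_at_within) (auto intro!: derivative_eq_intros E)
    then have "E - \<eta> \<ge> 0"
      by (rule max_right_deriv_nonneg) (use max[of _ r] t tr in auto)
    with \<open>E \<le> 0\<close> \<eta> show False by simp
  qed
qed

text \<open>Letting \<eta> tend to 0 covers \<open>t < b\<close> and \<open>0 < r\<close>; the final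
  time and the centre, where \<open>subsol\<close> states no inequality, follow by
  continuity.\<close>

theorem maximum_principle:
  assumes f: "subsol a b f" and init: "\<And>r. r \<in> {0..2} \<Longrightarrow> f a r \<le> 0"
    and t: "t \<in> {a..b}" and r: "r \<in> {0..2}"
  shows "f t r \<le> 0"
proof (cases "a < b")
  case False
  then have "t = a" using t by auto
  then show ?thesis using init r by auto
next
  case True
  have inner: "f t r \<le> 0" if "a \<le> t" "t < b" "0 < r" "r \<le> 2" for t r
  proof (rule field_le_epsilon)
    fix e :: real assume "e > 0"
    define K where "K = 1 / r + (t - a)"
    have "K > 0" using that by (simp add: K_def add_pos_nonneg)
    have "f t r \<le> (e / K) * K"
      using maximum_principle_interior[OF f init that, of "e / K"] \<open>e > 0\<close> \<open>K > 0\<close> by (simp add: K_def)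
    then show "f t r \<le> 0 + e" using \<open>K > 0\<close> by simp
  qed
  have "(\<lambda>(t, r). f t r) (t, r) \<le> 0"
  proof (rule continuous_le_on_closure[where S = "{a..<b} \<times> {0<..2}"])
    have cl: "closure ({a..<b} \<times> {0<..(2::real)}) = {a..b} \<times> {0..2}"
      using True by (simp add: closure_Times)
    show "continuous_on (closure ({a..<b} \<times> {0<..2})) (\<lambda>(t, r). f t r)"
      unfolding cl using f by (simp add: subsol_def)
    show "(t, r) \<in> closure ({a..<b} \<times> {0<..2})" unfolding cl using t r by simp
  qed (use inner in auto)
  then show ?thesis by simp
qed

section \<open>Constructing subsolutions\<close>

lemma subsol_add:
  assumes f: "subsol a b f" and g: "subsol a b g"
  shows "subsol a b (\<lambda>t r. f t r + g t r)"
  unfolding subsol_def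
proof (intro conjI ballI)
  have "continuous_on ({a..b} \<times> {0..2}) (\<lambda>p. (\<lambda>(t, r). f t r) p + (\<lambda>(t, r). g t r) p)"
    using f g by (intro continuous_on_add) (auto simp: subsol_def)
  then show "continuous_on ({a..b} \<times> {0..2}) (\<lambda>(t, r). f t r + g t r)"
    by (simp add: case_prod_beta)
next
  fix t assume t: "t \<in> {a<..<b}"
  obtain v where v: "\<And>r. r\<in>{0<..<2} - {1} \<Longrightarrow> (f t has_real_derivative v r) (at r) \<and>
           (\<exists>D E. ((\<lambda>x. x\<^sup>2 * v x) has_real_derivative D) (at r) \<and>
                  ((\<lambda>s. f s r) has_real_derivative E) (at t) \<and> E \<le> diffusivity r / r\<^sup>2 * D)"
    using f t unfolding subsol_def by blast
  obtain w where w: "\<And>r. r\<in>{0<..<2} - {1} \<Longrightarrow> (g t has_real_derivative w r) (at r) \<and>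
           (\<exists>D E. ((\<lambda>x. x\<^sup>2 * w x) has_real_derivative D) (at r) \<and>
                  ((\<lambda>s. g s r) has_real_derivative E) (at t) \<and> E \<le> diffusivity r / r\<^sup>2 * D)"
    using g t unfolding subsol_def by blast
  show "\<exists>v. \<forall>r\<in>{0<..<2} - {1}. ((\<lambda>r. f t r + g t r) has_real_derivative v r) (at r) \<and>
           (\<exists>D E. ((\<lambda>x. x\<^sup>2 * v x) has_real_derivative D) (at r) \<and>
                  ((\<lambda>s. f s r + g s r) has_real_derivative E) (at t) \<and> E \<le> diffusivity r / r\<^sup>2 * D)"
  proof (rule exI[of _ "\<lambda>r. v r + w r"], intro ballI conjI)
    fix r :: real assume r: "r \<in> {0<..<2} - {1}"
    show "((\<lambda>r. f t r + g t r) has_real_derivative v r + w r) (at r)"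
      using v[OF r] w[OF r] by (auto intro!: derivative_intros)
    obtain D E D' E' where *: "((\<lambda>x. x\<^sup>2 * v x) has_real_derivative D) (at r)"
        "((\<lambda>s. f s r) has_real_derivative E) (at t)" "E \<le> diffusivity r / r\<^sup>2 * D"
        "((\<lambda>x. x\<^sup>2 * w x) has_real_derivative D') (at r)"
        "((\<lambda>s. g s r) has_real_derivative E') (at t)" "E' \<le> diffusivity r / r\<^sup>2 * D'"
      using v[OF r] w[OF r] by blast
    show "\<exists>D E. ((\<lambda>x. x\<^sup>2 * (v x + w x)) has_real_derivative D) (at r) \<and>
                  ((\<lambda>s. f s r + g s r) has_real_derivative E) (at t) \<and> E \<le> diffusivity r / r\<^sup>2 * D"
    proof (intro exI conjI)
      show "((\<lambda>x. x\<^sup>2 * (v x + w x)) has_real_derivative D + D') (at r)"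
        using DERIV_add[OF *(1) *(4)] by (simp add: distrib_left)
      show "((\<lambda>s. f s r + g s r) has_real_derivative E + E') (at t)"
        by (rule DERIV_add[OF *(2) *(5)])
      show "E + E' \<le> diffusivity r / r\<^sup>2 * (D + D')"
        using *(3,6) by (simp add: distrib_left)
    qed
  qed
  obtain DY DW where *: "(f t has_real_derivative DY) (at 1 within {0..1})"
      "(f t has_real_derivative DW) (at 1 within {1..2})" "17 * DY \<le> 26 * DW"
    using f t unfolding subsol_def by blast
  obtain DY' DW' where **: "(g t has_real_derivative DY') (at 1 within {0..1})"
      "(g t has_real_derivative DW') (at 1 within {1..2})" "17 * DY' \<le> 26 * DW'"
    using g t unfolding subsol_def by blast
  show "\<exists>DY DW. ((\<lambda>r. f t r + g t r) has_real_derivative DY) (at 1 within {0..1}) \<and>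
                 ((\<lambda>r. f t r + g t r) has_real_derivative DW) (at 1 within {1..2}) \<and> 17 * DY \<le> 26 * DW"
    using DERIV_add[OF *(1) **(1)] DERIV_add[OF *(2) **(2)] *(3) **(3)
    by (intro exI[of _ "DY + DY'"] exI[of _ "DW + DW'"]) (simp add: algebra_simps)
  obtain D D' where *: "(f t has_real_derivative D) (at 2 within {1..2})" "26 * D + 550 * f t 2 \<le> 0"
      "(g t has_real_derivative D') (at 2 within {1..2})" "26 * D' + 550 * g t 2 \<le> 0"
    using f g t unfolding subsol_def by blast
  show "\<exists>D. ((\<lambda>r. f t r + g t r) has_real_derivative D) (at 2 within {1..2}) \<and>
            26 * D + 550 * (f t 2 + g t 2) \<le> 0"
    using DERIV_add[OF *(1,3)] *(2,4) by (intro exI[of _ "D + D'"]) (simp add: algebra_simps)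
qed

lemma subsol_scale:
  assumes f: "subsol a b f" and c: "0 \<le> c"
  shows "subsol a b (\<lambda>t r. c * f t r)"
  unfolding subsol_def
proof (intro conjI ballI)
  have "continuous_on ({a..b} \<times> {0..2}) (\<lambda>p. c * (\<lambda>(t, r). f t r) p)"
    using f by (intro continuous_intros) (auto simp: subsol_def)
  then show "continuous_on ({a..b} \<times> {0..2}) (\<lambda>(t, r). c * f t r)"
    by (simp add: case_prod_beta)
next
  fix t assume t: "t \<in> {a<..<b}"
  obtain v where v: "\<And>r. r\<in>{0<..<2} - {1} \<Longrightarrow> (f t has_real_derivative v r) (at r) \<and>
           (\<exists>D E. ((\<lambda>x. x\<^sup>2 * v x) has_real_derivative D) (at r) \<and>
                  ((\<lambda>s. f s r) has_real_derivative E) (at t) \<and> E \<le> diffusivity r / r\<^sup>2 * D)"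
    using f t unfolding subsol_def by blast
  show "\<exists>v. \<forall>r\<in>{0<..<2} - {1}. ((\<lambda>r. c * f t r) has_real_derivative v r) (at r) \<and>
           (\<exists>D E. ((\<lambda>x. x\<^sup>2 * v x) has_real_derivative D) (at r) \<and>
                  ((\<lambda>s. c * f s r) has_real_derivative E) (at t) \<and> E \<le> diffusivity r / r\<^sup>2 * D)"
  proof (rule exI[of _ "\<lambda>r. c * v r"], intro ballI conjI)
    fix r :: real assume r: "r \<in> {0<..<2} - {1}"
    show "((\<lambda>r. c * f t r) has_real_derivative c * v r) (at r)"
      using v[OF r] by (auto intro!: DERIV_cmult)
    obtain D E where *: "((\<lambda>x. x\<^sup>2 * v x) has_real_derivative D) (at r)"
        "((\<lambda>s. f s r) has_real_derivative E) (at t)" "E \<le> diffusivity r / r\<^sup>2 * D"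
      using v[OF r] by blast
    have "c * E \<le> diffusivity r / r\<^sup>2 * (c * D)"
      using mult_left_mono[OF *(3) c] by (simp add: algebra_simps)
    then show "\<exists>D E. ((\<lambda>x. x\<^sup>2 * (c * v x)) has_real_derivative D) (at r) \<and>
                  ((\<lambda>s. c * f s r) has_real_derivative E) (at t) \<and> E \<le> diffusivity r / r\<^sup>2 * D"
      using DERIV_cmult[OF *(1), of c] DERIV_cmult[OF *(2), of c]
      by (intro exI[of _ "c * D"] exI[of _ "c * E"]) (simp add: mult.left_commute)
  qed
  obtain DY DW where *: "(f t has_real_derivative DY) (at 1 within {0..1})"
      "(f t has_real_derivative DW) (at 1 within {1..2})" "17 * DY \<le> 26 * DW"
    using f t unfolding subsol_def by blast
  have "17 * (c * DY) \<le> 26 * (c * DW)" using mult_left_mono[OF *(3) c] by (simp add: algebra_simps)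
  then show "\<exists>DY DW. ((\<lambda>r. c * f t r) has_real_derivative DY) (at 1 within {0..1}) \<and>
                 ((\<lambda>r. c * f t r) has_real_derivative DW) (at 1 within {1..2}) \<and> 17 * DY \<le> 26 * DW"
    using DERIV_cmult[OF *(1), of c] DERIV_cmult[OF *(2), of c] by blast
  obtain D where *: "(f t has_real_derivative D) (at 2 within {1..2})" "26 * D + 550 * f t 2 \<le> 0"
    using f t unfolding subsol_def by blast
  have "26 * (c * D) + 550 * (c * f t 2) \<le> 0" using mult_left_mono[OF *(2) c] by (simp add: algebra_simps)
  then show "\<exists>D. ((\<lambda>r. c * f t r) has_real_derivative D) (at 2 within {1..2}) \<and>
            26 * D + 550 * (c * f t 2) \<le> 0"
    using DERIV_cmult[OF *(1), of c] by blast
qed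

lemma subsol_const: "c \<le> 0 \<Longrightarrow> subsol a b (\<lambda>_ _. c)"
  unfolding subsol_def
  by (intro conjI ballI exI[of _ "\<lambda>_. 0"] exI[of _ 0]) (auto intro!: derivative_eq_intros)

lemma subsol_subset:
  assumes "subsol a b f" "a \<le> a'" "b' \<le> b"
  shows "subsol a' b' f"
proof -
  have "{a'..b'} \<times> {0..2::real} \<subseteq> {a..b} \<times> {0..2}" "{a'<..<b'} \<subseteq> {a<..<b}" using assms by auto
  then show ?thesis using assms(1) unfolding subsol_def
    by (meson continuous_on_subset subsetD)
qed

lemma subsol_shift:
  assumes f: "subsol a b f"
  shows "subsol (a - d) (b - d) (\<lambda>t. f (t + d))"
proof -
  have c: "continuous_on ({a-d..b-d} \<times> {0..2}) (\<lambda>(t, r). f (t + d) r)"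
  proof -
    have "continuous_on ({a-d..b-d} \<times> {0..2}) (\<lambda>p. (\<lambda>(t, r). f t r) (fst p + d, snd p))"
      by (rule continuous_on_compose2[where t = "{a..b} \<times> {0..2}"])
        (use f in \<open>auto simp: subsol_def intro!: continuous_intros\<close>)
    then show ?thesis by (simp add: case_prod_beta)
  qed
  have s: "((\<lambda>s. f (s + d) r) has_real_derivative E) (at t)"
    if "((\<lambda>s. f s r) has_real_derivative E) (at (t + d))" for E r t
    using that DERIV_at_within_shift[of "\<lambda>s. f s r" E d t UNIV]
    by (simp add: DERIV_shift add.commute)
  show ?thesis
    unfolding subsol_def
  proof (rule conjI[OF c], intro ballI)
    fix t assume "t \<in> {a - d<..<b - d}"
    then have t: "t + d \<in> {a<..<b}" by auto
    have 1: "\<exists>v. \<forall>r\<in>{0<..<2} - {1}. (f (t + d) has_real_derivative v r) (at r) \<and>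
           (\<exists>D E. ((\<lambda>x. x\<^sup>2 * v x) has_real_derivative D) (at r) \<and>
                  ((\<lambda>s. f (s + d) r) has_real_derivative E) (at t) \<and> E \<le> diffusivity r / r\<^sup>2 * D)"
      using f t s unfolding subsol_def by meson
    show "(\<exists>v. \<forall>r\<in>{0<..<2} - {1}. (f (t + d) has_real_derivative v r) (at r) \<and>
           (\<exists>D E. ((\<lambda>x. x\<^sup>2 * v x) has_real_derivative D) (at r) \<and>
                  ((\<lambda>s. f (s + d) r) has_real_derivative E) (at t) \<and> E \<le> diffusivity r / r\<^sup>2 * D)) \<and>
        (\<exists>DY DW. (f (t + d) has_real_derivative DY) (at 1 within {0..1}) \<and>
                 (f (t + d) has_real_derivative DW) (at 1 within {1..2}) \<and> 17 * DY \<le> 26 * DW) \<and>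
        (\<exists>D. (f (t + d) has_real_derivative D) (at 2 within {1..2}) \<and> 26 * D + 550 * f (t + d) 2 \<le> 0)"
      using f t 1 unfolding subsol_def by blast
  qed
qed

text \<open>Entry point for explicit formulas. Since (r^2 f')' = r^2 (f'' + (2/r) f'), the flux form
  of the equation becomes the familiar radial Laplacian. The formulas extend across their end
  points, which supplies the one-sided derivatives.\<close>

lemma subsol_pieces:
  fixes g gt gr grr w wt wr wrr :: "real \<Rightarrow> real \<Rightarrow> real"
  assumes contY: "continuous_on ({a..b} \<times> {0..1}) (\<lambda>(t, r). g t r)"
    and contW: "continuous_on ({a..b} \<times> {1..2}) (\<lambda>(t, r). w t r)"
    and join: "\<And>t. t \<in> {a..b} \<Longrightarrow> g t 1 = w t 1"
    and Y: "\<And>t r. t \<in> {a<..<b} \<Longrightarrow> r \<in> {0<..1} \<Longrightarrow> (g t has_real_derivative gr t r) (at r)"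
      "\<And>t r. t \<in> {a<..<b} \<Longrightarrow> r \<in> {0<..<1} \<Longrightarrow> (gr t has_real_derivative grr t r) (at r)"
      "\<And>t r. t \<in> {a<..<b} \<Longrightarrow> r \<in> {0<..<1} \<Longrightarrow> ((\<lambda>s. g s r) has_real_derivative gt t r) (at t)"
      "\<And>t r. t \<in> {a<..<b} \<Longrightarrow> r \<in> {0<..<1} \<Longrightarrow> gt t r \<le> 13 / 100 * (grr t r + 2 / r * gr t r)"
    and W: "\<And>t r. t \<in> {a<..<b} \<Longrightarrow> r \<in> {1..2} \<Longrightarrow> (w t has_real_derivative wr t r) (at r)"
      "\<And>t r. t \<in> {a<..<b} \<Longrightarrow> r \<in> {1<..<2} \<Longrightarrow> (wr t has_real_derivative wrr t r) (at r)"
      "\<And>t r. t \<in> {a<..<b} \<Longrightarrow> r \<in> {1<..<2} \<Longrightarrow> ((\<lambda>s. w s r) has_real_derivative wt t r) (at t)"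
      "\<And>t r. t \<in> {a<..<b} \<Longrightarrow> r \<in> {1<..<2} \<Longrightarrow> wt t r \<le> 17 / 100 * (wrr t r + 2 / r * wr t r)"
    and flux: "\<And>t. t \<in> {a<..<b} \<Longrightarrow> 17 * gr t 1 \<le> 26 * wr t 1"
    and robin: "\<And>t. t \<in> {a<..<b} \<Longrightarrow> 26 * wr t 2 + 550 * w t 2 \<le> 0"
  shows "subsol a b (\<lambda>t r. if r < 1 then g t r else w t r)"
  unfolding subsol_def
proof (intro conjI ballI)
  let ?f = "\<lambda>t r. if r < 1 then g t r else w t r"
  have "continuous_on ({a..b} \<times> {0..1} \<union> {a..b} \<times> {1..2}) (\<lambda>(t, r). ?f t r)"
  proof (rule continuous_on_closed_Un)
    show "continuous_on ({a..b} \<times> {0..1}) (\<lambda>(t, r). ?f t r)"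
      by (rule continuous_on_eq[OF contY]) (auto simp: join)
    show "continuous_on ({a..b} \<times> {1..2}) (\<lambda>(t, r). ?f t r)"
      by (rule continuous_on_eq[OF contW]) auto
  qed (auto intro!: closed_Times)
  moreover have "{a..b} \<times> {0..1} \<union> {a..b} \<times> {1..2} = {a..b} \<times> {0..(2::real)}" by auto
  ultimately show "continuous_on ({a..b} \<times> {0..2}) (\<lambda>(t, r). ?f t r)" by simp
next
  let ?f = "\<lambda>t r. if r < 1 then g t r else w t r"
  fix t assume t: "t \<in> {a<..<b}"
  have yolk: "((\<lambda>r. if r < 1 then F r else G r) has_real_derivative D) (at r)"
    if "(F has_real_derivative D) (at r)" "r < 1" for F G :: "real \<Rightarrow> real" and D r
    by (rule has_field_derivative_transform_within_open[OF that(1), of "{..<1}"]) (use that in auto)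
  have white: "((\<lambda>r. if r < 1 then F r else G r) has_real_derivative D) (at r)"
    if "(G has_real_derivative D) (at r)" "r > 1" for F G :: "real \<Rightarrow> real" and D r
    by (rule has_field_derivative_transform_within_open[OF that(1), of "{1<..}"]) (use that in auto)
  let ?v = "\<lambda>r. if r < 1 then gr t r else wr t r"
  have second: "((\<lambda>x. x\<^sup>2 * V x) has_real_derivative 2 * r * V r + r\<^sup>2 * D) (at r)"
    if "(V has_real_derivative D) (at r)" for V :: "real \<Rightarrow> real" and D r
    using DERIV_mult[OF DERIV_pow[of 2 r UNIV] that] by (simp add: algebra_simps)
  have lap: "k / r\<^sup>2 * (2 * r * F + r\<^sup>2 * G) = k * (G + 2 / r * F)" if "r > 0" for k r F G :: real
    using that by (simp add: field_simps power2_eq_square)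
  show "\<exists>v. \<forall>r\<in>{0<..<2} - {1}. (?f t has_real_derivative v r) (at r) \<and>
           (\<exists>D E. ((\<lambda>x. x\<^sup>2 * v x) has_real_derivative D) (at r) \<and>
                  ((\<lambda>s. ?f s r) has_real_derivative E) (at t) \<and> E \<le> diffusivity r / r\<^sup>2 * D)"
  proof (rule exI[of _ ?v], intro ballI conjI)
    fix r :: real assume r: "r \<in> {0<..<2} - {1}"
    show "(?f t has_real_derivative ?v r) (at r)"
      using yolk[OF Y(1)[OF t]] white[OF W(1)[OF t]] r by (cases "r < 1") auto
    show "\<exists>D E. ((\<lambda>x. x\<^sup>2 * ?v x) has_real_derivative D) (at r) \<and>
                  ((\<lambda>s. ?f s r) has_real_derivative E) (at t) \<and> E \<le> diffusivity r / r\<^sup>2 * D"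
    proof (cases "r < 1")
      have rpos: "r > 0" using r by auto
      case True
      then have r': "r \<in> {0<..<1}" "diffusivity r = 13 / 100" using r by (auto simp: diffusivity_def)
      have "gt t r \<le> diffusivity r / r\<^sup>2 * (2 * r * gr t r + r\<^sup>2 * grr t r)"
        unfolding r'(2) lap[OF rpos] by (rule Y(4)[OF t r'(1)])
      then show ?thesis
        using second[OF yolk[OF Y(2)[OF t r'(1)] True], of "wr t"] Y(3)[OF t r'(1)] True by auto
    next
      have rpos: "r > 0" using r by auto
      case False
      then have r': "r \<in> {1<..<2}" "diffusivity r = 17 / 100" using r by (auto simp: diffusivity_def)
      then have "r > 1" by simp
      have "wt t r \<le> diffusivity r / r\<^sup>2 * (2 * r * wr t r + r\<^sup>2 * wrr t r)"
        unfolding r'(2) lap[OF rpos] by (rule W(4)[OF t r'(1)])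
      then show ?thesis
        using second[OF white[OF W(2)[OF t r'(1)] \<open>r > 1\<close>], of "gr t"] W(3)[OF t r'(1)] False by auto
    qed
  qed
  show "\<exists>DY DW. (?f t has_real_derivative DY) (at 1 within {0..1}) \<and>
                 (?f t has_real_derivative DW) (at 1 within {1..2}) \<and> 17 * DY \<le> 26 * DW"
  proof (intro exI conjI)
    show "(?f t has_real_derivative gr t 1) (at 1 within {0..1})"
      by (rule has_field_derivative_transform_within
          [OF has_field_derivative_at_within[OF Y(1)[OF t]], of _ 1]) (use join[of t] t in auto)
    show "(?f t has_real_derivative wr t 1) (at 1 within {1..2})"
      by (rule has_field_derivative_transform_within
          [OF has_field_derivative_at_within[OF W(1)[OF t]], of _ 1]) auto
  qed (rule flux[OF t])
  show "\<exists>D. (?f t has_real_derivative D) (at 2 within {1..2}) \<and> 26 * D + 550 * ?f t 2 \<le> 0"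
  proof (intro exI conjI)
    show "(?f t has_real_derivative wr t 2) (at 2 within {1..2})"
      by (rule has_field_derivative_transform_within
          [OF has_field_derivative_at_within[OF W(1)[OF t]], of _ 1]) auto
  qed (use robin[OF t] in simp)
qed

section \<open>Solutions with constant bath temperature: comparison, contraction, decay\<close>

definition heat_sol :: "real \<Rightarrow> real \<Rightarrow> real \<Rightarrow> (real \<Rightarrow> real \<Rightarrow> real) \<Rightarrow> bool" where
  "heat_sol a b B u \<longleftrightarrow> subsol a b (\<lambda>t r. u t r - B) \<and> subsol a b (\<lambda>t r. B - u t r)"

lemma heat_sol_subset: "heat_sol a b B u \<Longrightarrow> a \<le> a' \<Longrightarrow> b' \<le> b \<Longrightarrow> heat_sol a' b' B u"
  unfolding heat_sol_def using subsol_subset by blast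

lemma heat_sol_shift: "heat_sol a b B u \<Longrightarrow> heat_sol (a - d) (b - d) B (\<lambda>t. u (t + d))"
  unfolding heat_sol_def using subsol_shift[of a b "\<lambda>t r. u t r - B" d] subsol_shift[of a b "\<lambda>t r. B - u t r" d]
  by simp

lemma heat_sol_const: "heat_sol a b c (\<lambda>_ _. c)"
  unfolding heat_sol_def using subsol_const[of 0] by simp

lemma heat_sol_continuous:
  assumes "heat_sol a b B u"
  shows "continuous_on ({a..b} \<times> {0..2}) (\<lambda>(t, r). u t r)"
proof -
  have "continuous_on ({a..b} \<times> {0..2}) (\<lambda>p. (\<lambda>(t, r). u t r - B) p + B)"
    using assms by (intro continuous_intros) (auto simp: heat_sol_def subsol_def)
  then show ?thesis by (simp add: case_prod_beta)
qed

text \<open>Nonpositive constants are subsolutions, so the difference of the solutions may be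
  corrected by \<open>B - B' - c\<close>.\<close>

lemma heat_sol_le:
  assumes u: "heat_sol a b B u" and v: "heat_sol a b B' v" and "B \<le> B'" "0 \<le> c"
    and init: "\<And>r. r \<in> {0..2} \<Longrightarrow> u a r \<le> v a r + c"
    and t: "t \<in> {a..b}" and r: "r \<in> {0..2}"
  shows "u t r \<le> v t r + c"
proof -
  have "subsol a b (\<lambda>t r. ((u t r - B) + (B' - v t r)) + (B - B' - c))"
    using u v assms(3,4) by (intro subsol_add subsol_const) (auto simp: heat_sol_def)
  from maximum_principle[OF this _ t r] init show ?thesis by fastforce
qed

lemma heat_sol_mono:
  assumes "heat_sol a b B u" "heat_sol a b B' v" "B \<le> B'"
    and "\<And>r. r \<in> {0..2} \<Longrightarrow> u a r \<le> v a r" "t \<in> {a..b}" "r \<in> {0..2}"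
  shows "u t r \<le> v t r"
  using heat_sol_le[OF assms(1-3) order_refl _ assms(5,6)] assms(4) by simp

lemma heat_sol_le_const:
  assumes "heat_sol a b B u" "B \<le> c" "\<And>r. r \<in> {0..2} \<Longrightarrow> u a r \<le> c" "t \<in> {a..b}" "r \<in> {0..2}"
  shows "u t r \<le> c"
  using heat_sol_le[OF assms(1) heat_sol_const[of a b c] assms(2), of 0] assms by auto

lemma heat_sol_ge_const:
  assumes "heat_sol a b B u" "c \<le> B" "\<And>r. r \<in> {0..2} \<Longrightarrow> c \<le> u a r" "t \<in> {a..b}" "r \<in> {0..2}"
  shows "c \<le> u t r"
  using heat_sol_le[OF heat_sol_const[of a b c] assms(1) assms(2), of 0] assms by auto

text \<open>With \<open>c = 0\<close> this is uniqueness; with \<open>c > 0\<close> it is the source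
  of continuity in the parameters.\<close>

lemma heat_sol_contraction:
  assumes "heat_sol a b B u" "heat_sol a b B v" "0 \<le> c"
    and "\<And>r. r \<in> {0..2} \<Longrightarrow> \<bar>u a r - v a r\<bar> \<le> c" and "t \<in> {a..b}" "r \<in> {0..2}"
  shows "\<bar>u t r - v t r\<bar> \<le> c"
proof -
  have "u a r \<le> v a r + c" "v a r \<le> u a r + c" if "r \<in> {0..2}" for r
    using assms(4)[OF that] by linarith+
  then show ?thesis
    using heat_sol_le[OF assms(1,2) order_refl assms(3)] heat_sol_le[OF assms(2,1) order_refl assms(3)] assms(5,6)
    by (smt (verit))
qed

lemma heat_sol_uniform_continuity:
  assumes "heat_sol a b B u" and "e > 0"
  obtains d where "d > 0" "\<And>s t r. s \<in> {a..b} \<Longrightarrow> t \<in> {a..b} \<Longrightarrow> \<bar>s - t\<bar> < d \<Longrightarrow> r \<in> {0..2} \<Longrightarrow>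
     \<bar>u s r - u t r\<bar> < e"
proof -
  have "uniformly_continuous_on ({a..b} \<times> {0..2}) (\<lambda>(t, r). u t r)"
    by (rule compact_uniformly_continuous[OF heat_sol_continuous[OF assms(1)]])
      (intro compact_Times compact_Icc)
  then obtain d where d: "d > 0" "\<And>p q. p \<in> {a..b} \<times> {0..2} \<Longrightarrow> q \<in> {a..b} \<times> {0..2} \<Longrightarrow> dist q p < d \<Longrightarrow>
      dist ((\<lambda>(t, r). u t r) q) ((\<lambda>(t, r). u t r) p) < e"
    using assms(2) unfolding uniformly_continuous_on_def by meson
  show thesis
  proof (rule that[OF d(1)])
    fix s t r :: real assume "s \<in> {a..b}" "t \<in> {a..b}" "\<bar>s - t\<bar> < d" "r \<in> {0..2}"
    then show "\<bar>u s r - u t r\<bar> < e"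
      using d(2)[of "(t, r)" "(s, r)"] by (simp add: dist_prod_def dist_real_def)
  qed
qed

text \<open>The Laplacian of r^2 is 6, and 13/100 * 6 exceeds 3/20 * 5. The slope is negative, which
  suits the interface because 17 < 26; at r = 2 the value 1 outweighs the slope -4, as 550 > 26 *
  4.\<close>

lemma subsol_decay: "subsol a b (\<lambda>t r. - ((5 - r\<^sup>2) * exp (- (3 / 20) * (t - c))))"
proof -
  let ?E = "\<lambda>t. exp (- (3 / 20) * (t - c))"
  have "subsol a b (\<lambda>t r. if r < 1 then - ((5 - r\<^sup>2) * ?E t) else - ((5 - r\<^sup>2) * ?E t))"
  proof (rule subsol_pieces[where gr = "\<lambda>t r. 2 * r * ?E t" and grr = "\<lambda>t r. 2 * ?E t"
        and gt = "\<lambda>t r. 3 / 20 * (5 - r\<^sup>2) * ?E t" and wr = "\<lambda>t r. 2 * r * ?E t" and wrr = "\<lambda>t r. 2 * ?E t"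
        and wt = "\<lambda>t r. 3 / 20 * (5 - r\<^sup>2) * ?E t"])
    fix t r :: real
    have "3 / 20 * (5 - r\<^sup>2) * ?E t \<le> 3 / 4 * ?E t" by (intro mult_right_mono) auto
    also have "\<dots> \<le> 78 / 100 * ?E t" by (intro mult_right_mono) auto
    finally have *: "3 / 20 * (5 - r\<^sup>2) * ?E t \<le> 78 / 100 * ?E t" .
    show "3 / 20 * (5 - r\<^sup>2) * ?E t \<le> 13 / 100 * (2 * ?E t + 2 / r * (2 * r * ?E t))" if "r \<in> {0<..<1}"
      using * that by simp
    have "78 / 100 * ?E t \<le> 102 / 100 * ?E t" by (intro mult_right_mono) auto
    then show "3 / 20 * (5 - r\<^sup>2) * ?E t \<le> 17 / 100 * (2 * ?E t + 2 / r * (2 * r * ?E t))" if "r \<in> {1<..<2}"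
      using * that by simp
  qed (auto intro!: continuous_intros derivative_eq_intros simp: case_prod_beta)
  then show ?thesis by simp
qed

text \<open>The factor 5 is the ratio of the largest to the smallest value of 5 - r^2 on
  [0, 2].\<close>

lemma subsol_le_decay:
  assumes f: "subsol a b f" and "0 \<le> c" and init: "\<And>r. r \<in> {0..2} \<Longrightarrow> f a r \<le> c"
    and t: "t \<in> {a..b}" and r: "r \<in> {0..2}"
  shows "f t r \<le> 5 * c * exp (- (3 / 20) * (t - a))"
proof -
  let ?E = "exp (- (3 / 20) * (t - a))"
  have "subsol a b (\<lambda>t r. f t r + c * - ((5 - r\<^sup>2) * exp (- (3 / 20) * (t - a))))"
    by (intro subsol_add subsol_scale f subsol_decay assms(2))
  then have "f t r + c * - ((5 - r\<^sup>2) * ?E) \<le> 0"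
  proof (rule maximum_principle[OF _ _ t r])
    fix r :: real assume r: "r \<in> {0..2}"
    then have "r\<^sup>2 \<le> 2\<^sup>2" by (intro power_mono) auto
    then have "c * 1 \<le> c * (5 - r\<^sup>2)" using assms(2) by (intro mult_left_mono) auto
    then show "f a r + c * - ((5 - r\<^sup>2) * exp (- (3 / 20) * (a - a))) \<le> 0" using init[OF r] by (simp add: algebra_simps)
  qed
  moreover have "(5 - r\<^sup>2) * ?E \<le> 5 * ?E" by (intro mult_right_mono) auto
  then have "c * ((5 - r\<^sup>2) * ?E) \<le> c * (5 * ?E)" using assms(2) by (rule mult_left_mono)
  ultimately show ?thesis by simp
qed

section \<open>Explicit barriers with piecewise polynomial profiles\<close>

primrec heval :: "int list \<Rightarrow> real \<Rightarrow> real" where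
  "heval [] x = 0"
| "heval (c # cs) x = real_of_int c + x * heval cs x"

primrec leval :: "int list \<Rightarrow> int \<Rightarrow> int" where
  "leval [] x = 0"
| "leval (c # cs) x = c + x * leval cs x"

fun ladd :: "int list \<Rightarrow> int list \<Rightarrow> int list" where
  "ladd [] ys = ys"
| "ladd xs [] = xs"
| "ladd (x # xs) (y # ys) = (x + y) # ladd xs ys"

definition lscale :: "int \<Rightarrow> int list \<Rightarrow> int list" where
  "lscale c = map ((*) c)"

primrec lderiv :: "int list \<Rightarrow> int list" where
  "lderiv [] = []"
| "lderiv (c # cs) = ladd cs (0 # lderiv cs)"

lemma heval_leval: "heval cs (of_int n) = of_int (leval cs n)"
  by (induction cs) auto

lemma heval_ladd [simp]: "heval (ladd xs ys) x = heval xs x + heval ys x"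
  by (induction xs ys rule: ladd.induct) (auto simp: algebra_simps)

lemma heval_lscale [simp]: "heval (lscale c xs) x = of_int c * heval xs x"
  by (induction xs) (auto simp: lscale_def algebra_simps)

lemma heval_append_zeros [simp]: "heval (xs @ replicate n 0) x = heval xs x"
proof -
  have "heval (replicate n 0) x = 0" by (induction n) auto
  then show ?thesis by (induction xs) auto
qed

lemma heval_deriv [derivative_intros]:
  assumes "(f has_real_derivative D) (at x within S)"
  shows "((\<lambda>x. heval cs (f x)) has_real_derivative heval (lderiv cs) (f x) * D) (at x within S)"
  by (induction cs) (auto intro!: derivative_eq_intros assms simp: algebra_simps)

lemma continuous_on_heval [continuous_intros]:
  "continuous_on S f \<Longrightarrow> continuous_on S (\<lambda>x. heval cs (f x))"
  by (induction cs) (auto intro!: continuous_intros)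

text \<open>\<open>moebius [] cs\<close> lists the coefficients in \<open>u\<close> of \<open>(1 + u)^n p(1 / (1 + u))\<close>, where \<open>p\<close> has
  the coefficients \<open>cs\<close>; up to positive factors these are the Bernstein coefficients of \<open>p\<close> on \<open>[0, 1]\<close>.
  Padding with zeros raises the Bernstein degree.\<close>

primrec moebius :: "int list \<Rightarrow> int list \<Rightarrow> int list" where
  "moebius acc [] = acc"
| "moebius acc (c # cs) = moebius (ladd [c] (ladd acc (0 # acc))) cs"

definition bernstein_nonneg :: "int list \<Rightarrow> bool" where
  "bernstein_nonneg cs \<longleftrightarrow> list_all (\<lambda>c. 0 \<le> c) (moebius [] (cs @ replicate 8 0))"

text \<open>\<open>ladd acc (0 # acc)\<close> multiplies by \<open>1 + u\<close>, which is
  \<open>1 / x\<close>; the accumulator thus runs a Horner scheme in which every step costs one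
  factor \<open>x\<close>.\<close>

lemma heval_moebius:
  assumes "x > 0"
  shows "x ^ length cs * heval (moebius acc cs) (1 / x - 1) = heval acc (1 / x - 1) + x * heval cs x"
proof (induction cs arbitrary: acc)
  case (Cons c cs)
  then show ?case using assms by (simp add: Cons field_simps)
qed simp

lemma heval_nonneg: "list_all (\<lambda>c. 0 \<le> c) cs \<Longrightarrow> 0 \<le> x \<Longrightarrow> 0 \<le> heval cs x"
  by (induction cs) auto

lemma heval_nonneg_unit_interval:
  assumes "list_all (\<lambda>c. 0 \<le> c) (moebius [] (cs @ replicate k 0))" "0 \<le> x" "x \<le> 1"
  shows "0 \<le> heval cs x"
\<comment> \<open>The substitution \<open>u = 1 / x - 1\<close> excludes \<open>x = 0\<close>, which
  is recovered by continuity.\<close>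
proof (rule continuous_ge_on_closure[where S = "{0<..1::real}" and f = "heval cs"])
  show "continuous_on (closure {0<..1::real}) (heval cs)"
    by (intro continuous_intros)
  show "x \<in> closure {0<..1}" using assms by simp
  fix y :: real assume y: "y \<in> {0<..1}"
  let ?ds = "cs @ replicate k 0"
  have "0 \<le> y ^ length ?ds * heval (moebius [] ?ds) (1 / y - 1)"
    using assms(1) y by (intro mult_nonneg_nonneg heval_nonneg) auto
  also have "\<dots> = y * heval cs y" using heval_moebius[of y ?ds "[]"] y by simp
  finally show "0 \<le> heval cs y" using y by (simp add: zero_le_mult_iff)
qed

lemma bernstein_nonneg: "bernstein_nonneg cs \<Longrightarrow> 0 \<le> x \<Longrightarrow> x \<le> 1 \<Longrightarrow> 0 \<le> heval cs x"
  unfolding bernstein_nonneg_def by (rule heval_nonneg_unit_interval)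

text \<open>A profile consists of the coefficients of a polynomial in \<open>r\<^sup>2\<close> on the yolk \<open>r < 1\<close> and of one in
  \<open>r - 1\<close> on the white.\<close>

type_synonym profile = "int list \<times> int list"

text \<open>With z = r^2 the radial Laplacian of p(z) is 6 p' + 4 z p'', again a polynomial in
  z.\<close>

definition lap_yolk :: "int list \<Rightarrow> int list" where
  "lap_yolk zs = ladd (lscale 6 (lderiv zs)) (0 # lscale 4 (lderiv (lderiv zs)))"

definition mult_radius :: "int list \<Rightarrow> int list" where
  "mult_radius ys = ladd ys (0 # ys)"

text \<open>The profile \<open>q / D\<close> dominates the diffusion operator applied to \<open>p\<close>, and \<open>p\<close> satisfies the interface
  and boundary conditions of a supersolution. On the white the inequality is multiplied by \<open>r\<close>.\<close>

definition profile_rate :: "int \<Rightarrow> profile \<Rightarrow> profile \<Rightarrow> bool" where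
  "profile_rate D p q \<longleftrightarrow>
     (case p of (zs, ys) \<Rightarrow>
       leval zs 1 = leval ys 0 \<and>
       bernstein_nonneg (ladd (lscale 100 (fst q)) (lscale (- (13 * D)) (lap_yolk zs))) \<and>
       bernstein_nonneg (ladd (lscale 100 (mult_radius (snd q)))
         (lscale (- (17 * D)) (ladd (mult_radius (lderiv (lderiv ys))) (lscale 2 (lderiv ys))))) \<and>
       26 * leval (lderiv ys) 0 \<le> 34 * leval (lderiv zs) 1 \<and>
       0 \<le> 26 * leval (lderiv ys) 1 + 550 * leval ys 1)"

definition padd :: "profile \<Rightarrow> profile \<Rightarrow> profile" where
  "padd p q = (ladd (fst p) (fst q), ladd (snd p) (snd q))"

definition pscale :: "int \<Rightarrow> profile \<Rightarrow> profile" where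
  "pscale c p = (lscale c (fst p), lscale c (snd p))"

text \<open>The quadratic Bezier curve in time through \<open>A\<close> and \<open>C\<close> with control profile \<open>B\<close> is a supersolution
  for \<open>n / 20\<close> units of time.\<close>

definition bezier_ok :: "int \<Rightarrow> profile \<Rightarrow> profile \<Rightarrow> profile \<Rightarrow> bool" where
  "bezier_ok n A B C \<longleftrightarrow> 0 < n \<and>
     profile_rate n A (pscale 40 (padd B (pscale (- 1) A))) \<and>
     profile_rate n B (pscale 20 (padd C (pscale (- 1) A))) \<and>
     profile_rate n C (pscale 40 (padd C (pscale (- 1) B)))"

fun chain_ok :: "int list \<Rightarrow> profile list \<Rightarrow> bool" where
  "chain_ok [] ps \<longleftrightarrow> length ps = 1"
| "chain_ok (n # ns) (A # B # C # ps) \<longleftrightarrow> bezier_ok n A B C \<and> chain_ok ns (C # ps)"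
| "chain_ok _ _ \<longleftrightarrow> False"

text \<open>With \<open>q = exp (- (m / D) * t)\<close>, the function \<open>q A + q^3 (B - A) + q^6 (C - B)\<close> is a supersolution. The
  three conditions arise by summation by parts, since \<open>q - q^3\<close>, \<open>q^3 - q^6\<close>, \<open>q^6\<close> are nonnegative.\<close>

definition exp_ok :: "int \<Rightarrow> int \<Rightarrow> profile \<Rightarrow> profile \<Rightarrow> profile \<Rightarrow> bool" where
  "exp_ok m D A B C \<longleftrightarrow> 0 < D \<and> 0 \<le> m \<and>
     profile_rate D A (pscale (- m) A) \<and>
     profile_rate D B (pscale (- m) (padd (pscale 3 B) (pscale (- 2) A))) \<and>
     profile_rate D C (pscale (- m) (padd (pscale 6 C) (padd (pscale (- 3) B) (pscale (- 2) A))))"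

definition bounded_below :: "int \<Rightarrow> profile \<Rightarrow> bool" where
  "bounded_below c p \<longleftrightarrow> bernstein_nonneg (ladd (fst p) [- c]) \<and> bernstein_nonneg (ladd (snd p) [- c])"

text \<open>Barriers for the egg that cools from 1 in a bath of temperature 0: a supersolution \<open>cool_above\<close> and the
  negative \<open>cool_below\<close> of a subsolution, both multiplied by \<open>10^6\<close>.\<close>

definition cool_above :: "profile list" where
  "cool_above = [
    ([1000100, 3, -9, 8],
     [1000102, -27, 72528, -941235, 5644973, -15009991, 17908766, -7675015]),
    ([1000125, 473, -1819, 1964],
     [1000743, 2606, 46981, -617836, 3817141, -10904923, 14409181, -6857783]),
    ([1000168, 307, -1407, 1926],
     [1000994, 4240, 22433, -322255, 2182696, -6621890, 9809559, -5362644]),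
    ([1000230, 152, -1022, 2137],
     [1001497, 5873, 23058, -282320, 1751397, -4647282, 7224168, -4725004]),
    ([1000284, 95, -438, 2137],
     [1002078, 7325, 17982, 53227, -206404, 1457225, -2362086, 289747]),
    ([1001344, -5270, 9550, 1933],
     [1007557, 25628, 66344, -5217, -879992, 3566538, -7553743, 3931192]),
    ([1002631, -9851, 27176, -11423],
     [1008533, 13340, -86722, 209920, -1104133, 168767, -1082232, 996446]),
    ([1002403, -5669, 39417, -27378],
     [1008773, -11766, -139469, -288343, -2697174, 4132518, -2760180, 846339]),
    ([1016970, -59205, 126031, -90389],
     [993407, -102444, -448586, -341986, -559352, 537006])]"

definition cool_above_exp1 :: profile where
  "cool_above_exp1 =
    ([2017717, -1036009, 159012, -10937],
     [1129783, -981848, -502411, 526588, -154190, 24646])"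

definition cool_above_exp2 :: profile where
  "cool_above_exp2 =
    ([651144, 1037236, -744983, 134934],
     [1078331, -62712, -1638084, 313302, 648358, -281782])"

definition cool_below :: "profile list" where
  "cool_below = [
    ([-999900, 14, -36, 23],
     [-999899, -23, 141240, -1733514, 9791773, -24708798, 27499816, -10195531]),
    ([-999820, 2387, -7511, 6272],
     [-998672, 8042, 89720, -1327809, 7305590, -18859003, 22709424, -9071335]),
    ([-999757, 1954, -6655, 6272],
     [-998186, 9715, 44591, -790498, 4657776, -12345654, 16405732, -7125818]),
    ([-999631, 1089, -4943, 6272],
     [-997213, 3054, 74429, -326429, 884007, -1048184, 4322976, -3019803]),
    ([-999518, 1607, -5874, 8333],
     [-995452, 19390, -3461, 810201, -3108303, 9536880, -8897476, 2539587]),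
    ([-998780, 7733, -26212, 27754],
     [-989505, 50400, 200070, 816812, -1452895, 5247442, -5988184, 2037416]),
    ([-998112, 7282, -18344, 37008],
     [-972166, 106691, 376151, 474619, 167904, 807280, -1710259, 679534]),
    ([-993011, -18427, 36945, 33828],
     [-940665, 205200, 578283, 230338, 304005, -55855, -832869, 455684]),
    ([-990563, -611, 76058, 23165],
     [-891951, 279114, 485357, 707864, -822590, 192728])]"

definition cool_below_exp1 :: profile where
  "cool_below_exp1 =
    ([-1633113, 877736, -140982, 9760],
     [-886599, 817338, 274189, -242203, 6210, 7647])"

definition cool_below_exp2 :: profile where
  "cool_below_exp2 =
    ([-887930, -473853, 568576, -129162],
     [-922369, 360642, 849660, -164296, -228741, 60078])"

text \<open>The steps grow as the initial jump between egg and bath smooths out, and add up to 13/20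
  units of time; from then on the exponential form continues from the last profile. The rate 2/5
  here and 21/50 for \<open>cool_below\<close> bound the slowest decay rate from below and
  above.\<close>

lemma cool_above_ok: "chain_ok [1, 2, 4, 6] cool_above"
  "exp_ok 2 5 cool_above_exp1 cool_above_exp2 (last cool_above)"
  "bounded_below 1000000 (hd cool_above)"
  by code_simp+

lemma cool_below_ok: "chain_ok [1, 2, 4, 6] cool_below"
  "exp_ok 21 50 cool_below_exp1 cool_below_exp2 (last cool_below)"
  "bounded_below (- 1000000) (hd cool_below)"
  by code_simp+

section \<open>From integer certificates to barriers\<close>

definition peval :: "profile \<Rightarrow> real \<Rightarrow> real" where
  "peval p r = (if r < 1 then heval (fst p) (r\<^sup>2) else heval (snd p) (r - 1))"

lemma heval_lap_yolk: "heval (lap_yolk zs) x = 6 * heval (lderiv zs) x + 4 * x * heval (lderiv (lderiv zs)) x"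
  by (simp add: lap_yolk_def)

lemma heval_mult_radius: "heval (mult_radius ys) x = (1 + x) * heval ys x"
  by (simp add: mult_radius_def algebra_simps)

lemma profile_rateD:
  assumes "profile_rate D (zs, ys) q" "0 < D"
  shows "heval zs 1 = heval ys 0"
    and "0 \<le> x \<Longrightarrow> x \<le> 1 \<Longrightarrow> 13 / 100 * heval (lap_yolk zs) x \<le> heval (fst q) x / D"
    and "0 \<le> x \<Longrightarrow> x \<le> 1 \<Longrightarrow>
      17 / 100 * (heval (lderiv (lderiv ys)) x + 2 / (1 + x) * heval (lderiv ys) x) \<le> heval (snd q) x / D"
    and "26 * heval (lderiv ys) 0 \<le> 34 * heval (lderiv zs) 1"
    and "0 \<le> 26 * heval (lderiv ys) 1 + 550 * heval ys 1"
proof -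
  note q = assms(1)[unfolded profile_rate_def prod.case]
  show "heval zs 1 = heval ys 0"
    using q heval_leval[of zs 1] heval_leval[of ys 0] by simp
  show "26 * heval (lderiv ys) 0 \<le> 34 * heval (lderiv zs) 1"
  proof -
    have "real_of_int (26 * leval (lderiv ys) 0) \<le> real_of_int (34 * leval (lderiv zs) 1)"
      using q by (simp only: of_int_le_iff)
    then show ?thesis using heval_leval[of "lderiv ys" 0] heval_leval[of "lderiv zs" 1] by simp
  qed
  show "0 \<le> 26 * heval (lderiv ys) 1 + 550 * heval ys 1"
  proof -
    have "real_of_int 0 \<le> real_of_int (26 * leval (lderiv ys) 1 + 550 * leval ys 1)"
      using q by (simp only: of_int_le_iff)
    then show ?thesis using heval_leval[of "lderiv ys" 1] heval_leval[of "ys" 1] by simp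
  qed
  assume x: "0 \<le> x" "x \<le> 1"
  have D: "real_of_int D > 0" using assms(2) by simp
  have "0 \<le> heval (ladd (lscale 100 (fst q)) (lscale (- (13 * D)) (lap_yolk zs))) x"
    using q x by (intro bernstein_nonneg) auto
  then have "13 / 100 * heval (lap_yolk zs) x * D \<le> heval (fst q) x" by (simp add: mult_ac)
  then show "13 / 100 * heval (lap_yolk zs) x \<le> heval (fst q) x / D"
    using D by (simp add: pos_le_divide_eq)
  let ?a = "heval (lderiv (lderiv ys)) x" and ?b = "heval (lderiv ys) x"
  have "0 \<le> heval (ladd (lscale 100 (mult_radius (snd q)))
         (lscale (- (17 * D)) (ladd (mult_radius (lderiv (lderiv ys))) (lscale 2 (lderiv ys))))) x"
    using q x by (intro bernstein_nonneg) auto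
  then have "17 / 100 * ((1 + x) * ?a + 2 * ?b) * D \<le> (1 + x) * heval (snd q) x"
    by (simp add: heval_mult_radius mult_ac)
  also have "17 / 100 * ((1 + x) * ?a + 2 * ?b) * D = (1 + x) * (17 / 100 * (?a + 2 / (1 + x) * ?b) * D)"
    using x by (simp add: field_simps)
  finally have "17 / 100 * (?a + 2 / (1 + x) * ?b) * D \<le> heval (snd q) x"
    by (rule mult_left_le_imp_le) (use x in simp)
  then show "17 / 100 * (?a + 2 / (1 + x) * ?b) \<le> heval (snd q) x / D"
    using D by (simp add: pos_le_divide_eq)
qed

text \<open>The conditions on a profile are linear, so they survive summation with nonnegative time
  weights. It remains that the weighted rates are exactly the time derivative, which is
  \<open>Wderiv\<close>; Bezier and exponential weights are the two instances.\<close>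

lemma subsol_profiles:
  fixes W :: "nat \<Rightarrow> real \<Rightarrow> real"
  assumes D: "0 < D" and rate: "\<And>j. j < n \<Longrightarrow> profile_rate D (P j) (Q j)"
    and Wpos: "\<And>j t. j < n \<Longrightarrow> t \<in> {a<..<b} \<Longrightarrow> 0 \<le> W j t"
    and Wcont: "\<And>j. j < n \<Longrightarrow> continuous_on {a..b} (W j)"
    and Wderiv: "\<And>sel t x. sel = fst \<or> sel = snd \<Longrightarrow> t \<in> {a<..<b} \<Longrightarrow>
      ((\<lambda>s. \<Sum>j<n. W j s * heval (sel (P j)) x) has_real_derivative
        (\<Sum>j<n. W j t * (heval (sel (Q j)) x / D))) (at t)"
  shows "subsol a b (\<lambda>t r. - (\<Sum>j<n. W j t * peval (P j) r))"
proof -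
  let ?y = "\<lambda>j. fst (P j)" and ?w = "\<lambda>j. snd (P j)"
  have rate': "profile_rate D (?y j, ?w j) (Q j)" if "j < n" for j using rate[OF that] by simp
  note R = profile_rateD[OF rate' D]
  have "subsol a b (\<lambda>t r. if r < 1 then - (\<Sum>j<n. W j t * heval (?y j) (r\<^sup>2))
      else - (\<Sum>j<n. W j t * heval (?w j) (r - 1)))"
  proof (rule subsol_pieces[where
        gr = "\<lambda>t r. - (\<Sum>j<n. W j t * (heval (lderiv (?y j)) (r\<^sup>2) * (2 * r)))" and
        grr = "\<lambda>t r. - (\<Sum>j<n. W j t * (heval (lderiv (lderiv (?y j))) (r\<^sup>2) * (2 * r) * (2 * r)
                  + heval (lderiv (?y j)) (r\<^sup>2) * 2))" and
        gt = "\<lambda>t r. - (\<Sum>j<n. W j t * (heval (fst (Q j)) (r\<^sup>2) / D))" and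
        wr = "\<lambda>t r. - (\<Sum>j<n. W j t * heval (lderiv (?w j)) (r - 1))" and
        wrr = "\<lambda>t r. - (\<Sum>j<n. W j t * heval (lderiv (lderiv (?w j))) (r - 1))" and
        wt = "\<lambda>t r. - (\<Sum>j<n. W j t * (heval (snd (Q j)) (r - 1) / D))"])
    have Wc: "continuous_on ({a..b} \<times> S) (\<lambda>p. W j (fst p))" if "j < n" for j and S :: "real set"
      by (rule continuous_on_compose2[OF Wcont[OF that]]) (auto intro!: continuous_intros)
    show "continuous_on ({a..b} \<times> {0..1}) (\<lambda>(t, r). - (\<Sum>j<n. W j t * heval (?y j) (r\<^sup>2)))"
      "continuous_on ({a..b} \<times> {1..2}) (\<lambda>(t, r). - (\<Sum>j<n. W j t * heval (?w j) (r - 1)))"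
      unfolding case_prod_beta by (intro continuous_intros Wc; simp)+
    show "- (\<Sum>j<n. W j t * heval (?y j) (1\<^sup>2)) = - (\<Sum>j<n. W j t * heval (?w j) (1 - 1))" for t
      using R(1) by simp
    fix t assume t: "t \<in> {a<..<b}"
    note pos = Wpos[OF _ t]
    show "17 * - (\<Sum>j<n. W j t * (heval (lderiv (?y j)) (1\<^sup>2) * (2 * 1)))
        \<le> 26 * - (\<Sum>j<n. W j t * heval (lderiv (?w j)) (1 - 1))"
    proof -
      \<comment> \<open>The derivative of p(r^2) at r = 1 is 2 p'(1), whence 34 = 2 * 17.\<close>
      have "(\<Sum>j<n. W j t * (26 * heval (lderiv (?w j)) 0)) \<le> (\<Sum>j<n. W j t * (34 * heval (lderiv (?y j)) 1))"
        by (intro sum_mono mult_left_mono R(4) pos) auto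
      then show ?thesis by (simp add: sum_distrib_left sum_distrib_right mult_ac)
    qed
    show "26 * - (\<Sum>j<n. W j t * heval (lderiv (?w j)) (2 - 1)) + 550 * - (\<Sum>j<n. W j t * heval (?w j) (2 - 1)) \<le> 0"
    proof -
      have "0 \<le> (\<Sum>j<n. W j t * (26 * heval (lderiv (?w j)) 1 + 550 * heval (?w j) 1))"
        by (intro sum_nonneg mult_nonneg_nonneg R(5) pos) auto
      then show ?thesis by (simp add: sum_distrib_left sum_distrib_right mult_ac distrib_left sum.distrib)
    qed
    fix r :: real
    show "((\<lambda>r. - (\<Sum>j<n. W j t * heval (?y j) (r\<^sup>2))) has_real_derivative
        - (\<Sum>j<n. W j t * (heval (lderiv (?y j)) (r\<^sup>2) * (2 * r)))) (at r)"
      by (intro derivative_eq_intros sum.cong arg_cong[of _ _ uminus]; (rule refl)?) auto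
    show "((\<lambda>r. - (\<Sum>j<n. W j t * (heval (lderiv (?y j)) (r\<^sup>2) * (2 * r)))) has_real_derivative
        - (\<Sum>j<n. W j t * (heval (lderiv (lderiv (?y j))) (r\<^sup>2) * (2 * r) * (2 * r)
                  + heval (lderiv (?y j)) (r\<^sup>2) * 2))) (at r)"
      by (intro derivative_eq_intros sum.cong arg_cong[of _ _ uminus]; (rule refl)?) (auto simp: algebra_simps)
    show "((\<lambda>s. - (\<Sum>j<n. W j s * heval (?y j) (r\<^sup>2))) has_real_derivative
        - (\<Sum>j<n. W j t * (heval (fst (Q j)) (r\<^sup>2) / D))) (at t)"
      by (rule DERIV_minus[OF Wderiv[OF _ t]]) simp
    show "((\<lambda>r. - (\<Sum>j<n. W j t * heval (?w j) (r - 1))) has_real_derivative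
        - (\<Sum>j<n. W j t * heval (lderiv (?w j)) (r - 1))) (at r)"
      by (intro derivative_eq_intros sum.cong arg_cong[of _ _ uminus]; (rule refl)?) auto
    show "((\<lambda>r. - (\<Sum>j<n. W j t * heval (lderiv (?w j)) (r - 1))) has_real_derivative
        - (\<Sum>j<n. W j t * heval (lderiv (lderiv (?w j))) (r - 1))) (at r)"
      by (intro derivative_eq_intros sum.cong arg_cong[of _ _ uminus]; (rule refl)?) auto
    show "((\<lambda>s. - (\<Sum>j<n. W j s * heval (?w j) (r - 1))) has_real_derivative
        - (\<Sum>j<n. W j t * (heval (snd (Q j)) (r - 1) / D))) (at t)"
      by (rule DERIV_minus[OF Wderiv[OF _ t]]) simp
    show "- (\<Sum>j<n. W j t * (heval (fst (Q j)) (r\<^sup>2) / D)) \<le> 13 / 100 *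
        (- (\<Sum>j<n. W j t * (heval (lderiv (lderiv (?y j))) (r\<^sup>2) * (2 * r) * (2 * r)
                  + heval (lderiv (?y j)) (r\<^sup>2) * 2))
         + 2 / r * - (\<Sum>j<n. W j t * (heval (lderiv (?y j)) (r\<^sup>2) * (2 * r))))" if r: "r \<in> {0<..<1}"
    proof -
      have "r\<^sup>2 \<le> 1" using r by (simp add: power_le_one)
      then have "(\<Sum>j<n. W j t * (13 / 100 * heval (lap_yolk (?y j)) (r\<^sup>2)))
          \<le> (\<Sum>j<n. W j t * (heval (fst (Q j)) (r\<^sup>2) / D))"
        by (intro sum_mono mult_left_mono R(2) pos) auto
      moreover have "(\<Sum>j<n. W j t * (13 / 100 * heval (lap_yolk (?y j)) (r\<^sup>2))) = 13 / 100 *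
        ((\<Sum>j<n. W j t * (heval (lderiv (lderiv (?y j))) (r\<^sup>2) * (2 * r) * (2 * r)
                  + heval (lderiv (?y j)) (r\<^sup>2) * 2))
         + 2 / r * (\<Sum>j<n. W j t * (heval (lderiv (?y j)) (r\<^sup>2) * (2 * r))))"
        unfolding sum_distrib_left sum.distrib[symmetric]
        by (intro sum.cong refl) (use r in \<open>simp add: heval_lap_yolk field_simps power2_eq_square\<close>)
      ultimately show ?thesis by (simp only: mult_minus_right minus_add_distrib[symmetric] neg_le_iff_le)
    qed
    show "- (\<Sum>j<n. W j t * (heval (snd (Q j)) (r - 1) / D)) \<le> 17 / 100 *
        (- (\<Sum>j<n. W j t * heval (lderiv (lderiv (?w j))) (r - 1))
         + 2 / r * - (\<Sum>j<n. W j t * heval (lderiv (?w j)) (r - 1)))" if r: "r \<in> {1<..<2}"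
    proof -
      have "(\<Sum>j<n. W j t * (17 / 100 * (heval (lderiv (lderiv (?w j))) (r - 1)
            + 2 / (1 + (r - 1)) * heval (lderiv (?w j)) (r - 1))))
          \<le> (\<Sum>j<n. W j t * (heval (snd (Q j)) (r - 1) / D))"
        by (intro sum_mono mult_left_mono R(3) pos) (use r in auto)
      moreover have "(\<Sum>j<n. W j t * (17 / 100 * (heval (lderiv (lderiv (?w j))) (r - 1)
            + 2 / (1 + (r - 1)) * heval (lderiv (?w j)) (r - 1)))) = 17 / 100 *
        ((\<Sum>j<n. W j t * heval (lderiv (lderiv (?w j))) (r - 1))
         + 2 / r * (\<Sum>j<n. W j t * heval (lderiv (?w j)) (r - 1)))"
        unfolding sum_distrib_left sum.distrib[symmetric]
        by (intro sum.cong refl) (use r in \<open>simp add: field_simps\<close>)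
      ultimately show ?thesis by (simp only: mult_minus_right minus_add_distrib[symmetric] neg_le_iff_le)
    qed
  qed
  moreover have "(\<lambda>t r. if r < 1 then - (\<Sum>j<n. W j t * heval (?y j) (r\<^sup>2))
      else - (\<Sum>j<n. W j t * heval (?w j) (r - 1))) = (\<lambda>t r. - (\<Sum>j<n. W j t * peval (P j) r))"
    by (auto simp: peval_def fun_eq_iff)
  ultimately show ?thesis by simp
qed

lemma heval_fst_snd_padd:
  "sel = fst \<or> sel = snd \<Longrightarrow> heval (sel (padd p q)) x = heval (sel p) x + heval (sel q) x"
  "sel = fst \<or> sel = snd \<Longrightarrow> heval (sel (pscale c p)) x = of_int c * heval (sel p) x"
  by (auto simp: padd_def pscale_def)

text \<open>Raised to degree 2, the time derivative of the curve has the control profiles 2 (B - A),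
  C - A and 2 (C - B), divided by the duration h = n/20. These are the rates in
  \<open>bezier_ok\<close>, and the Bernstein weights are nonnegative.\<close>

lemma subsol_le_bezier:
  assumes f: "subsol a b f" and ok: "bezier_ok n A B C" and b: "a + n / 20 \<le> b"
    and init: "\<And>r. r \<in> {0..2} \<Longrightarrow> f a r \<le> peval A r" and r: "r \<in> {0..2}"
  shows "f (a + n / 20) r \<le> peval C r"
proof -
  define h where "h = real_of_int n / 20"
  have n: "0 < n" using ok by (simp add: bezier_ok_def)
  then have h: "h > 0" "real_of_int n = 20 * h" by (simp_all add: h_def)
  define s where "s t = (t - a) / h" for t
  let ?W = "\<lambda>j t. [(1 - s t)\<^sup>2, 2 * s t * (1 - s t), (s t)\<^sup>2] ! j"
  let ?P = "\<lambda>j. [A, B, C] ! j"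
  let ?Q = "\<lambda>j. [pscale 40 (padd B (pscale (- 1) A)), pscale 20 (padd C (pscale (- 1) A)),
     pscale 40 (padd C (pscale (- 1) B))] ! j"
  have "subsol a (a + h) (\<lambda>t r. - (\<Sum>j<3. ?W j t * peval (?P j) r))"
  proof (rule subsol_profiles[OF n, where Q = ?Q])
    show "profile_rate n (?P j) (?Q j)" if "j < 3" for j
      using ok that by (auto simp: bezier_ok_def less_Suc_eq numeral_3_eq_3)
    show "0 \<le> ?W j t" if "j < 3" "t \<in> {a<..<a + h}" for j t
    proof -
      have "0 \<le> s t" "s t \<le> 1" using that h by (auto simp: s_def field_simps)
      then show ?thesis using that by (auto simp: less_Suc_eq numeral_3_eq_3)
    qed
    show "continuous_on {a..a + h} (?W j)" if "j < 3" for j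
      using that h by (auto simp: less_Suc_eq numeral_3_eq_3 s_def intro!: continuous_intros)
    fix sel :: "profile \<Rightarrow> int list" and t x :: real
    assume sel: "sel = fst \<or> sel = snd" and t: "t \<in> {a<..<a + h}"
    have ds: "(s has_real_derivative 1 / h) (at t)"
      unfolding s_def using h by (auto intro!: derivative_eq_intros)
    show "((\<lambda>s. \<Sum>j<3. ?W j s * heval (sel (?P j)) x) has_real_derivative
        (\<Sum>j<3. ?W j t * (heval (sel (?Q j)) x / n))) (at t)"
      using h(1) by (auto intro!: derivative_eq_intros ds
          simp: numeral_3_eq_3 heval_fst_snd_padd[OF sel] h(2) field_simps power2_eq_square)
  qed
  then have "subsol a (a + h) (\<lambda>t r. f t r + - (\<Sum>j<3. ?W j t * peval (?P j) r))"
    by (intro subsol_add subsol_subset[OF f]) (use b in \<open>auto simp: h_def\<close>)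
  from maximum_principle[OF this _ _ r, of "a + h"] init h
  have "f (a + h) r \<le> peval C r" by (auto simp: numeral_3_eq_3 s_def)
  then show ?thesis by (simp add: h_def)
qed

lemma subsol_le_chain:
  assumes "subsol a b f" "chain_ok ns ps" "a + real_of_int (sum_list ns) / 20 \<le> b"
    and "\<And>r. r \<in> {0..2} \<Longrightarrow> f a r \<le> peval (hd ps) r" and "r \<in> {0..2}"
  shows "f (a + real_of_int (sum_list ns) / 20) r \<le> peval (last ps) r"
  using assms
proof (induction ns ps arbitrary: a r rule: chain_ok.induct)
  case (1 ps)
  then show ?case by (cases ps) auto
next
  case (2 n ns A B C ps)
  have pos: "0 \<le> sum_list ns'" if "chain_ok ns' ps'" for ns' ps'
    using that by (induction ns' ps' rule: chain_ok.induct) (auto simp: bezier_ok_def)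
  have ok: "bezier_ok n A B C" "chain_ok ns (C # ps)" using "2.prems"(2) by auto
  have ns: "0 \<le> real_of_int (sum_list ns)" "0 < n" using pos[OF ok(2)] ok(1) by (auto simp: bezier_ok_def)
  have step: "f (a + n / 20) r \<le> peval (hd (C # ps)) r" if "r \<in> {0..2}" for r
    using subsol_le_bezier[OF "2.prems"(1) ok(1) _ _ that] "2.prems"(3,4) ns by (simp add: add_divide_distrib)
  have "f (a + n / 20 + real_of_int (sum_list ns) / 20) r \<le> peval (last (C # ps)) r"
  proof (rule "2.IH")
    show "subsol (a + n / 20) b f" by (rule subsol_subset[OF "2.prems"(1)]) (use ns in auto)
    show "a + n / 20 + real_of_int (sum_list ns) / 20 \<le> b" using "2.prems"(3) by (simp add: add_divide_distrib)
  qed (fact ok(2) step "2.prems"(5))+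
  then show ?case by (simp add: add_divide_distrib add.assoc)
qed auto

lemma subsol_exp_profiles:
  fixes c :: real
  assumes ok: "exp_ok m D A B C"
  defines "q \<equiv> \<lambda>t. exp (- (m / D) * (t - c))"
  shows "subsol c b (\<lambda>t r. - ((q t - q t ^ 3) * peval A r + (q t ^ 3 - q t ^ 6) * peval B r + q t ^ 6 * peval C r))"
proof -
  have D: "0 < D" and m: "0 \<le> m" using ok by (simp_all add: exp_ok_def)
  let ?W = "\<lambda>j t. [q t - q t ^ 3, q t ^ 3 - q t ^ 6, q t ^ 6] ! j"
  let ?P = "\<lambda>j. [A, B, C] ! j"
  let ?Q = "\<lambda>j. [pscale (- m) A, pscale (- m) (padd (pscale 3 B) (pscale (- 2) A)),
     pscale (- m) (padd (pscale 6 C) (padd (pscale (- 3) B) (pscale (- 2) A)))] ! j"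
  have "subsol c b (\<lambda>t r. - (\<Sum>j<3. ?W j t * peval (?P j) r))"
  proof (rule subsol_profiles[OF D, where Q = ?Q])
    show "profile_rate D (?P j) (?Q j)" if "j < 3" for j
      using ok that by (auto simp: exp_ok_def less_Suc_eq numeral_3_eq_3)
    show "0 \<le> ?W j t" if "j < 3" "t \<in> {c<..<b}" for j t
    proof -
      have "0 \<le> (m / D) * (t - c)" using that m D by auto
      then have q: "0 \<le> q t" "q t \<le> 1" unfolding q_def by auto
      have "q t ^ 3 \<le> q t ^ 1" "q t ^ 6 \<le> q t ^ 3" by (rule power_decreasing; use q in simp)+
      then show ?thesis using that q by (auto simp: less_Suc_eq numeral_3_eq_3)
    qed
    have cq: "continuous_on S q" for S unfolding q_def by (intro continuous_intros)
    show "continuous_on {c..b} (?W j)" if "j < 3" for j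
      using that by (auto simp: less_Suc_eq numeral_3_eq_3 intro!: continuous_intros cq)
    fix sel :: "profile \<Rightarrow> int list" and t x :: real
    assume sel: "sel = fst \<or> sel = snd"
    have dq: "(q has_real_derivative - (m / D) * q t) (at t)"
      unfolding q_def using D by (auto intro!: derivative_eq_intros)
    show "((\<lambda>s. \<Sum>j<3. ?W j s * heval (sel (?P j)) x) has_real_derivative
        (\<Sum>j<3. ?W j t * (heval (sel (?Q j)) x / D))) (at t)"
      using D by (auto intro!: derivative_eq_intros dq
          simp: numeral_3_eq_3 heval_fst_snd_padd[OF sel] field_simps eval_nat_numeral)
  qed
  then show ?thesis by (simp add: numeral_3_eq_3)
qed

definition exp_profile :: "real \<Rightarrow> profile \<Rightarrow> profile \<Rightarrow> profile \<Rightarrow> real \<Rightarrow> real" where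
  "exp_profile q A B C r = (q - q ^ 3) * peval A r + (q ^ 3 - q ^ 6) * peval B r + q ^ 6 * peval C r"

lemma bounded_belowD:
  assumes "bounded_below c p" "r \<in> {0..2}"
  shows "of_int c \<le> peval p r"
proof (cases "r < 1")
  case True
  then have "0 \<le> heval (ladd (fst p) [- c]) (r\<^sup>2)"
    using assms by (intro bernstein_nonneg) (auto simp: bounded_below_def power_le_one)
  then show ?thesis using True by (simp add: peval_def)
next
  case False
  then have "0 \<le> heval (ladd (snd p) [- c]) (r - 1)"
    using assms by (intro bernstein_nonneg) (auto simp: bounded_below_def)
  then show ?thesis using False by (simp add: peval_def)
qed

lemma subsol_le_exp_profile:
  assumes f: "subsol a b f" and ok: "exp_ok m D A B C" and "c \<le> a"
    and init: "\<And>r. r \<in> {0..2} \<Longrightarrow> f a r \<le> exp_profile (exp (- (m / D) * (a - c))) A B C r"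
    and t: "t \<in> {a..b}" and r: "r \<in> {0..2}"
  shows "f t r \<le> exp_profile (exp (- (m / D) * (t - c))) A B C r"
proof -
  have "subsol a b (\<lambda>t r. f t r + - exp_profile (exp (- (m / D) * (t - c))) A B C r)"
    unfolding exp_profile_def
    by (intro subsol_add f subsol_subset[OF subsol_exp_profiles[OF ok, of c b]]) (use assms(3) in auto)
  from maximum_principle[OF this _ t r] init show ?thesis by fastforce
qed

text \<open>At time \<open>c\<close> the exponential is 1 and the exponential form equals
  \<open>last ps\<close>, so the chain hands over without loss.\<close>

lemma subsol_le_chain_exp:
  assumes f: "subsol a b f" and chain: "chain_ok ns ps" and ok: "exp_ok m D A B (last ps)"
    and k: "bounded_below k (hd ps)" and c: "c = a + real_of_int (sum_list ns) / 20"
    and init: "\<And>r. r \<in> {0..2} \<Longrightarrow> f a r \<le> of_int k"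
    and t: "t \<in> {c..b}" "a \<le> c" and r: "r \<in> {0..2}"
  shows "f t r \<le> exp_profile (exp (- (m / D) * (t - c))) A B (last ps) r"
proof (rule subsol_le_exp_profile[OF _ ok order_refl _ t(1) r])
  show "subsol c b f" using subsol_subset[OF f t(2) order_refl] .
  fix r :: real assume r: "r \<in> {0..2}"
  have "f a r \<le> peval (hd ps) r" if "r \<in> {0..2}" for r
    using init[OF that] bounded_belowD[OF k that] by linarith
  then have "f c r \<le> peval (last ps) r"
    unfolding c by (intro subsol_le_chain[OF f chain _ _ r]) (use t c in auto)
  then show "f c r \<le> exp_profile (exp (- (m / D) * (c - c))) A B (last ps) r"
    by (simp add: exp_profile_def)
qed

section \<open>Values of the barriers at the two measured points\<close>

definition cooling_above :: "real \<Rightarrow> real \<Rightarrow> real" where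
  "cooling_above q = exp_profile q cool_above_exp1 cool_above_exp2 (last cool_above)"

definition cooling_below :: "real \<Rightarrow> real \<Rightarrow> real" where
  "cooling_below q = exp_profile q cool_below_exp1 cool_below_exp2 (last cool_below)"

lemma cooling_above_white: "cooling_above q (7 / 4) \<le> 290008 * q + 90319 * q ^ 3 + 90096 * q ^ 6" if "0 \<le> q"
proof -
  have "cooling_above q (7 / 4) = q * peval cool_above_exp1 (7 / 4)
     + q ^ 3 * (peval cool_above_exp2 (7 / 4) - peval cool_above_exp1 (7 / 4))
     + q ^ 6 * (peval (last cool_above) (7 / 4) - peval cool_above_exp2 (7 / 4))"
    by (simp add: cooling_above_def exp_profile_def algebra_simps)
  also have "\<dots> \<le> q * 290008 + q ^ 3 * 90319 + q ^ 6 * 90096"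
    using that by (intro add_mono mult_left_mono zero_le_power)
      (simp_all add: peval_def cool_above_exp1_def cool_above_exp2_def cool_above_def)
  finally show ?thesis by (simp add: mult_ac)
qed

lemma cooling_above_centre: "cooling_above q 0 = 2017717 * q - 1366573 * q ^ 3 + 365826 * q ^ 6"
  by (simp add: cooling_above_def exp_profile_def peval_def cool_above_exp1_def cool_above_exp2_def
      cool_above_def algebra_simps)

lemma cooling_below_centre: "cooling_below q 0 = - 1633113 * q + 745183 * q ^ 3 - 102633 * q ^ 6"
  by (simp add: cooling_below_def exp_profile_def peval_def cool_below_exp1_def cool_below_exp2_def
      cool_below_def algebra_simps)

lemma cooling_above_centre_mono:
  assumes "0 \<le> q" "q \<le> q'" "q' \<le> 7 / 10"
  shows "cooling_above q 0 \<le> cooling_above q' 0"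
proof (rule DERIV_nonneg_imp_nondecreasing[OF assms(2)])
  fix x assume x: "q \<le> x" "x \<le> q'"
  \<comment> \<open>For x up to 7/10 the negative term stays just below 2017717, so the last term is
    only needed to be nonnegative.\<close>
  have "x\<^sup>2 \<le> (7 / 10)\<^sup>2" using x assms by (intro power_mono) auto
  moreover have "0 \<le> x ^ 5" using x assms by auto
  ultimately have "0 \<le> 2017717 - 1366573 * (3 * x\<^sup>2) + 365826 * (6 * x ^ 5)"
    by (simp add: power2_eq_square)
  moreover have "((\<lambda>q. cooling_above q 0) has_real_derivative
      2017717 - 1366573 * (3 * x\<^sup>2) + 365826 * (6 * x ^ 5)) (at x)"
    unfolding cooling_above_centre by (auto intro!: derivative_eq_intros)
  ultimately show "\<exists>y. ((\<lambda>q. cooling_above q 0) has_real_derivative y) (at x) \<and> 0 \<le> y" by blast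
qed

text \<open>Here 64000000 = 10^6 * (65 - 1), and \<open>s\<close> stands for
  \<open>exp (- (21 / 50) * x)\<close>, where \<open>x\<close> is the time since 11/4. Both decaying
  exponentials are replaced by bounds affine in \<open>s\<close>, which leaves a polynomial
  inequality on [0, 1].\<close>

lemma peak_polynomial:
  assumes "0 \<le> s" "s \<le> 1"
  shows "80 * (- 1633113 * (411 / 1000 * s) + 745183 * (411 / 1000 * s) ^ 3)
    + 99 * cooling_above (3 / 100 + 977 / 1000 * s) 0 < 64000000"
proof -
  \<comment> \<open>The coefficients in \<open>s\<close> of 10^18 times the distance to 63900000;
    the remaining 0.1 degree makes the inequality strict. The Bernstein degree is raised by 20 to
    certify their polynomial.\<close>
  let ?cs = "[57911033333226971754000000, -141106007701203019268400000, 11622082986705476231100000,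
    122011651066398732679320000, -445473409990372482609000, -5803033620807918873453240,
    -31497576930718537440910086]"
  have "0 \<le> heval ?cs s"
    by (rule heval_nonneg_unit_interval[where k = 20]) (code_simp, use assms in auto)
  also have "heval ?cs s = 10 ^ 18 * (63900000 - (80 * (- 1633113 * (411 / 1000 * s) + 745183 * (411 / 1000 * s) ^ 3)
    + 99 * cooling_above (3 / 100 + 977 / 1000 * s) 0))"
    unfolding cooling_above_centre by (simp add: field_simps eval_nat_numeral)
  finally show ?thesis by simp
qed

text \<open>The 9 is 3 * 3, a bound for exp 2 in the remainder term.\<close>

lemma exp_Taylor10:
  fixes x :: real
  assumes "\<bar>x\<bar> \<le> 2"
  shows "\<bar>exp x - (\<Sum>i\<le>10. x ^ i / fact i)\<bar> \<le> 9 * \<bar>x\<bar> ^ 11 / fact 10"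
proof -
  have "exp \<bar>x\<bar> \<le> exp (1 + 1)" using assms by simp
  also have "\<dots> \<le> 3 * 3" unfolding exp_add by (intro mult_mono exp_le) auto
  finally have "exp \<bar>x\<bar> * \<bar>x\<bar> ^ 11 / fact 10 \<le> 9 * \<bar>x\<bar> ^ 11 / fact 10"
    by (intro divide_right_mono mult_right_mono) auto
  then show ?thesis using Taylor_exp_field[of x 10] by simp
qed

lemma exp_horner10:
  fixes x :: real
  defines "H \<equiv> 1 + x * (1 + x / 2 * (1 + x / 3 * (1 + x / 4 * (1 + x / 5 * (1 + x / 6 * (1 + x / 7 *
        (1 + x / 8 * (1 + x / 9 * (1 + x / 10)))))))))"
  assumes "\<bar>x\<bar> \<le> 2"
  shows "exp x \<le> H + 9 * \<bar>x\<bar> ^ 11 / 3628800" "H - 9 * \<bar>x\<bar> ^ 11 / 3628800 \<le> exp x"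
proof -
  have "(\<Sum>i\<le>10. x ^ i / fact i) = H"
    unfolding H_def by (simp add: eval_nat_numeral fact_reduce field_simps)
  moreover have "fact 10 = (3628800 :: real)" by (simp add: fact_numeral)
  ultimately have "\<bar>exp x - H\<bar> \<le> 9 * \<bar>x\<bar> ^ 11 / 3628800"
    using exp_Taylor10[OF assms(2)] by (simp only:)
  then show "exp x \<le> H + 9 * \<bar>x\<bar> ^ 11 / 3628800" "H - 9 * \<bar>x\<bar> ^ 11 / 3628800 \<le> exp x"
    by linarith+
qed

text \<open>Most exponents are a decay rate times an elapsed time: 29/50 and 609/1000 belong to the
  end of the boiling, 63/50 and 189/500 to the time 73/20, and 441/500 to the lag 21/10 between the
  two barriers. The exponents 1/2 and 1/40 serve the exchange of rates below.\<close>

lemma exp_bounds: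
  "exp (- (29 / 50)) \<le> (57 / 100 :: real)"
  "(279 / 1000 :: real) \<le> exp (- (63 / 50))"
  "(411 / 1000 :: real) \<le> exp (- (441 / 500))"
  "exp (- (1 / 2)) \<le> (63 / 100 :: real)"
  "exp (1 / 40) \<le> (10257 / 10000 :: real)"
  "exp (- (189 / 500)) \<le> (6856 / 10000 :: real)"
  "exp (- (609 / 1000)) \<le> (11 / 20 :: real)"
proof -
  show "exp (- (29 / 50)) \<le> (57 / 100 :: real)"
    using exp_horner10(1)[of "- (29 / 50)"] by (simp add: power_divide)
  show "(279 / 1000 :: real) \<le> exp (- (63 / 50))"
    using exp_horner10(2)[of "- (63 / 50)"] by (simp add: power_divide)
  show "(411 / 1000 :: real) \<le> exp (- (441 / 500))"
    using exp_horner10(2)[of "- (441 / 500)"] by (simp add: power_divide)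
  show "exp (- (1 / 2)) \<le> (63 / 100 :: real)"
    using exp_horner10(1)[of "- (1 / 2)"] by (simp add: power_divide)
  show "exp (1 / 40) \<le> (10257 / 10000 :: real)"
    using exp_horner10(1)[of "1 / 40"] by (simp add: power_divide)
  show "exp (- (189 / 500)) \<le> (6856 / 10000 :: real)"
    using exp_horner10(1)[of "- (189 / 500)"] by (simp add: power_divide)
  show "exp (- (609 / 1000)) \<le> (11 / 20 :: real)"
    using exp_horner10(1)[of "- (609 / 1000)"] by (simp add: power_divide)
qed

text \<open>Expresses one decay rate by the other. Weighted AM-GM with equality near \<open>x = 5 / 4\<close>, close to the time
  at which the centre is hottest.\<close>

lemma exp_mix_le:
  fixes x :: real
  shows "exp (- (2 / 5) * x) \<le> 3 / 100 + 977 / 1000 * exp (- (21 / 50) * x)"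
proof -
  let ?y = "x - 5 / 4"
  \<comment> \<open>The weights satisfy 1/21 * 2/5 = 20/21 * 1/50, so the linear terms of the two
    tangent bounds cancel.\<close>
  have *: "1 \<le> 1 / 21 * exp (2 / 5 * ?y) + 20 / 21 * exp (- (1 / 50) * ?y)"
    using exp_ge_add_one_self[of "2 / 5 * ?y"] exp_ge_add_one_self[of "- (1 / 50) * ?y"]
    by (simp add: field_simps)
  have "exp (- (2 / 5) * x) * 1 \<le> exp (- (2 / 5) * x) *
      (1 / 21 * exp (2 / 5 * ?y) + 20 / 21 * exp (- (1 / 50) * ?y))"
    using * by (rule mult_left_mono) simp
  also have "\<dots> = 1 / 21 * exp (- (2 / 5) * x + 2 / 5 * ?y) + 20 / 21 * exp (- (2 / 5) * x - 1 / 50 * ?y)"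
    by (simp add: distrib_left exp_add[symmetric] mult.left_commute)
  also have "- (2 / 5) * x + 2 / 5 * ?y = - (1 / 2)" by (simp add: field_simps)
  also have "- (2 / 5) * x - 1 / 50 * ?y = 1 / 40 + - (21 / 50) * x" by (simp add: field_simps)
  also have "1 / 21 * exp (- (1 / 2)) + 20 / 21 * exp (1 / 40 + - (21 / 50) * x)
      \<le> 1 / 21 * (63 / 100) + 20 / 21 * (10257 / 10000 * exp (- (21 / 50) * x))"
    unfolding exp_add using exp_bounds(4,5) by (intro add_mono mult_left_mono mult_right_mono) auto
  also have "\<dots> \<le> 3 / 100 + 977 / 1000 * exp (- (21 / 50) * x)"
    by simp
  finally show ?thesis by simp
qed

section \<open>The family of heating protocols\<close>

text \<open>Indexing by the duration \<open>d\<close> instead of the end time makes the parameter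
  domain a product. For \<open>t1 = 0\<close> the first phase shrinks to the initial
  instant.\<close>

locale egg_family =
  fixes u :: "real \<Rightarrow> real \<Rightarrow> real \<Rightarrow> real \<Rightarrow> real"
  assumes initial: "0 \<le> t1 \<Longrightarrow> 0 < d \<Longrightarrow> r \<in> {0..2} \<Longrightarrow> u t1 d 0 r = 20"
    and warm: "0 \<le> t1 \<Longrightarrow> 0 < d \<Longrightarrow> heat_sol 0 t1 65 (u t1 d)"
    and boil: "0 \<le> t1 \<Longrightarrow> 0 < d \<Longrightarrow> heat_sol t1 (t1 + d) 100 (u t1 d)"
    and chill: "0 \<le> t1 \<Longrightarrow> 0 < d \<Longrightarrow> heat_sol (t1 + d) T 1 (u t1 d)"
begin

definition chilled :: "real \<Rightarrow> real \<Rightarrow> real \<Rightarrow> real \<Rightarrow> real" where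
  "chilled t1 d s = u t1 d (t1 + d + s)"

lemma chilled_sol: "0 \<le> t1 \<Longrightarrow> 0 < d \<Longrightarrow> heat_sol 0 T 1 (chilled t1 d)"
  using heat_sol_shift[OF chill[of t1 d "t1 + d + T"], of "t1 + d"]
  by (simp add: chilled_def[abs_def] add.commute add.left_commute)

lemma boil_sol: "0 \<le> t1 \<Longrightarrow> 0 < d \<Longrightarrow> heat_sol 0 d 100 (\<lambda>s. u t1 d (t1 + s))"
  using heat_sol_shift[OF boil[of t1 d], of t1] by (simp add: add.commute)

lemma warm_ge: "0 \<le> t1 \<Longrightarrow> 0 < d \<Longrightarrow> t \<in> {0..t1} \<Longrightarrow> r \<in> {0..2} \<Longrightarrow> 20 \<le> u t1 d t r"
  by (rule heat_sol_ge_const[OF warm[of t1 d]]) (simp_all add: initial)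

lemma warm_le: "0 \<le> t1 \<Longrightarrow> 0 < d \<Longrightarrow> t \<in> {0..t1} \<Longrightarrow> r \<in> {0..2} \<Longrightarrow> u t1 d t r \<le> 65"
  by (rule heat_sol_le_const[OF warm[of t1 d]]) (simp_all add: initial)

lemma boil_ge: "0 \<le> t1 \<Longrightarrow> 0 < d \<Longrightarrow> t \<in> {t1..t1 + d} \<Longrightarrow> r \<in> {0..2} \<Longrightarrow> 20 \<le> u t1 d t r"
  by (rule heat_sol_ge_const[OF boil[of t1 d]]) (simp_all add: warm_ge)

lemma boil_le: "0 \<le> t1 \<Longrightarrow> 0 < d \<Longrightarrow> t \<in> {t1..t1 + d} \<Longrightarrow> r \<in> {0..2} \<Longrightarrow> u t1 d t r \<le> 100"
  by (rule heat_sol_le_const[OF boil[of t1 d]]) (simp_all add: order_trans[OF warm_le])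

text \<open>Up to time \<open>t\<close> neither egg has left the first bath, so the rest of the
  protocol is invisible. This permits comparing one egg with another that is kept longer in that
  bath.\<close>

lemma warm_unique:
  assumes "0 \<le> t1" "0 < d" "0 \<le> t1'" "0 < d'" "0 \<le> t" "t \<le> t1" "t \<le> t1'" "r \<in> {0..2}"
  shows "u t1 d t r = u t1' d' t r"
proof -
  have "heat_sol 0 t 65 (u t1 d)" "heat_sol 0 t 65 (u t1' d')"
    using heat_sol_subset[OF warm] assms by auto
  from heat_sol_contraction[OF this order_refl, of t r] initial assms show ?thesis by auto
qed

text \<open>Time shift: the shifted solution starts at 20 or more, the original at 20, and
  comparison preserves the order.\<close>

lemma warm_mono:
  assumes "0 \<le> t1" "0 < d" "0 \<le> s" "s \<le> t" "t \<le> t1" and r: "r \<in> {0..2}"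
  shows "u t1 d s r \<le> u t1 d t r"
proof -
  let ?e = "t - s"
  have "u t1 d s r \<le> u t1 d (s + ?e) r"
  proof (rule heat_sol_mono[of 0 "t1 - ?e" 65 "u t1 d" 65 "\<lambda>s. u t1 d (s + ?e)"])
    show "heat_sol 0 (t1 - ?e) 65 (\<lambda>s. u t1 d (s + ?e))"
      using heat_sol_subset[OF heat_sol_shift[OF warm[of t1 d], of ?e], of 0 "t1 - ?e"] assms by simp
    show "heat_sol 0 (t1 - ?e) 65 (u t1 d)"
      using heat_sol_subset[OF warm[of t1 d], of 0 "t1 - ?e"] assms by simp
    show "u t1 d 0 r \<le> u t1 d (0 + ?e) r" if "r \<in> {0..2}" for r
      using initial[of t1 d r] warm_ge[of t1 d ?e r] assms(1-5) that by simp
    show "s \<in> {0..t1 - ?e}" using assms by simp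
  qed (rule order_refl, rule r)
  then show ?thesis by simp
qed

lemma boil_unique:
  assumes "0 \<le> t1" "0 < d" "d \<le> d'" "0 \<le> s" "s \<le> d" "r \<in> {0..2}"
  shows "u t1 d (t1 + s) r = u t1 d' (t1 + s) r"
proof -
  have "heat_sol 0 d 100 (\<lambda>s. u t1 d (t1 + s))" "heat_sol 0 d 100 (\<lambda>s. u t1 d' (t1 + s))"
    using heat_sol_subset[OF boil_sol[of t1 d'], of 0 d] boil_sol[of t1 d] assms by auto
  from heat_sol_contraction[OF this order_refl, of s r] warm_unique[of t1 d t1 d' t1] assms
  show ?thesis by auto
qed

text \<open>The time shift again. The state at \<open>t1\<close> is no longer constant, so
  \<open>start\<close> has to show that a further time \<open>e\<close> does not lower it.\<close>

lemma boil_mono: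
  assumes t1: "0 \<le> t1" and d: "0 < d" and st: "t1 \<le> s" "s \<le> t" "t \<le> t1 + d" and r: "r \<in> {0..2}"
  shows "u t1 d s r \<le> u t1 d t r"
proof -
  define e where "e = t - s"
  have e: "0 \<le> e" "e \<le> d" using st by (auto simp: e_def)
  have start: "u t1 d t1 r \<le> u t1 d (t1 + e) r" if r: "r \<in> {0..2}" for r
  proof -
    \<comment> \<open>The egg left at 65 for another \<open>e\<close>: it gets no colder, and the
      boiled egg is at least as warm. The boiling time 1 is arbitrary.\<close>
    let ?v = "u (t1 + e) 1"
    have "u t1 d t1 r = ?v t1 r" using warm_unique[of t1 d "t1 + e" 1 t1 r] t1 d e r by simp
    also have "\<dots> \<le> ?v (t1 + e) r" using warm_mono[of "t1 + e" 1 t1 "t1 + e" r] t1 e r by simp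
    also have "?v (t1 + e) r \<le> u t1 d (t1 + e) r + 0"
    proof (rule heat_sol_le[of t1 "t1 + e" 65 ?v 100 "u t1 d" 0])
      show "heat_sol t1 (t1 + e) 65 ?v" using heat_sol_subset[OF warm[of "t1 + e" 1]] t1 e by auto
      show "heat_sol t1 (t1 + e) 100 (u t1 d)" using heat_sol_subset[OF boil[OF t1 d]] e by auto
      show "?v t1 r \<le> u t1 d t1 r + 0" if "r \<in> {0..2}" for r
        using warm_unique[of t1 d "t1 + e" 1 t1 r] t1 d e that by simp
    qed (use e r in auto)
    finally show ?thesis by simp
  qed
  have "u t1 d s r \<le> u t1 d (s + e) r"
  proof (rule heat_sol_mono[of t1 "t1 + d - e" 100 "u t1 d" 100 "\<lambda>s. u t1 d (s + e)"])
    show "heat_sol t1 (t1 + d - e) 100 (u t1 d)"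
      using heat_sol_subset[OF boil[OF t1 d], of t1 "t1 + d - e"] e by simp
    show "heat_sol t1 (t1 + d - e) 100 (\<lambda>s. u t1 d (s + e))"
      using heat_sol_subset[OF heat_sol_shift[OF boil[OF t1 d], of e], of t1 "t1 + d - e"] e by simp
    show "s \<in> {t1..t1 + d - e}" using st by (simp add: e_def)
    show "u t1 d t1 r \<le> u t1 d (t1 + e) r" if "r \<in> {0..2}" for r by (rule start[OF that])
  qed (rule order_refl, rule r)
  then show ?thesis by (simp add: e_def)
qed

lemma mono_until_chilled:
  assumes "0 \<le> t1" "0 < d" "0 \<le> t" "t \<le> t1 + d" "r \<in> {0..2}"
  shows "u t1 d t r \<le> chilled t1 d 0 r"
proof (cases "t \<le> t1")
  case True
  then have "u t1 d t r \<le> u t1 d t1 r" using warm_mono[of t1 d t t1 r] assms by simp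
  also have "\<dots> \<le> u t1 d (t1 + d) r" using boil_mono[of t1 d t1 "t1 + d" r] assms by simp
  finally show ?thesis by (simp add: chilled_def)
next
  case False
  then show ?thesis using boil_mono[of t1 d t "t1 + d" r] assms by (simp add: chilled_def)
qed

text \<open>A longer first phase makes the start of the boiling hotter, a longer boiling its end;
  comparison carries both through the chill.\<close>

lemma chilled_mono:
  assumes "0 \<le> t1" "t1 \<le> t1'" "0 < d" "d \<le> d'" "0 \<le> s" "r \<in> {0..2}"
  shows "chilled t1 d s r \<le> chilled t1' d' s r"
proof -
  have boiled: "u t1 d (t1 + d) r \<le> u t1' d' (t1' + d) r" if r: "r \<in> {0..2}" for r
  proof (rule heat_sol_mono[of 0 d 100 "\<lambda>s. u t1 d (t1 + s)" 100 "\<lambda>s. u t1' d' (t1' + s)"])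
    show "heat_sol 0 d 100 (\<lambda>s. u t1 d (t1 + s))" "heat_sol 0 d 100 (\<lambda>s. u t1' d' (t1' + s))"
      using boil_sol[of t1 d] heat_sol_subset[OF boil_sol[of t1' d'], of 0 d] assms by simp_all
    show "u t1 d (t1 + 0) r \<le> u t1' d' (t1' + 0) r" if "r \<in> {0..2}" for r
      using warm_unique[of t1 d t1' d' t1 r] warm_mono[of t1' d' t1 t1' r] assms(1-5) that by simp
    show "d \<in> {0..d}" using assms(3) by simp
  qed (rule order_refl, rule r)
  show ?thesis
  proof (rule heat_sol_mono[of 0 s 1 "chilled t1 d" 1 "chilled t1' d'"])
    show "heat_sol 0 s 1 (chilled t1 d)" "heat_sol 0 s 1 (chilled t1' d')"
      using chilled_sol assms by simp_all
    show "chilled t1 d 0 r \<le> chilled t1' d' 0 r" if "r \<in> {0..2}" for r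
      using boiled[OF that] boil_mono[of t1' d' "t1' + d" "t1' + d'" r] assms that by (simp add: chilled_def)
    show "s \<in> {0..s}" using assms(5) by simp
  qed (rule order_refl, rule assms(6))
qed

lemma chilled_decay:
  assumes "0 \<le> t1" "0 < d" "0 \<le> s" "r \<in> {0..2}"
  shows "chilled t1 d s r \<le> 1 + 495 * exp (- (3 / 20) * s)"
proof -
  have "subsol 0 s (\<lambda>t r. chilled t1 d t r - 1)"
    using chilled_sol[of t1 d s] assms by (auto simp: heat_sol_def)
  moreover have "chilled t1 d 0 r - 1 \<le> 99" if "r \<in> {0..2}" for r
    using boil_le[of t1 d "t1 + d" r] that assms by (simp add: chilled_def)
  ultimately show ?thesis using subsol_le_decay[of 0 s "\<lambda>t r. chilled t1 d t r - 1" 99 s r] assms by simp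
qed

text \<open>The half-line is not compact, but the decay bound eventually drops below 20 while the
  chill starts at 20 or more, so a bounded time interval decides.\<close>

lemma chilled_attains_max:
  assumes td: "0 \<le> t1" "0 < d" and r: "r \<in> {0..2}"
  obtains s where "0 \<le> s" "\<And>s'. 0 \<le> s' \<Longrightarrow> chilled t1 d s' r \<le> chilled t1 d s r"
proof -
  have "((\<lambda>s::real. 1 + 495 * exp (- (3 / 20) * s)) \<longlongrightarrow> 1 + 495 * 0) at_top"
    by (intro tendsto_intros filterlim_compose[OF exp_at_bot]
        filterlim_tendsto_neg_mult_at_bot[OF tendsto_const _ filterlim_ident]) auto
  then have "\<forall>\<^sub>F s in at_top. 1 + 495 * exp (- (3 / 20) * s) < (20 :: real)"
    by (rule order_tendstoD) simp
  then obtain N where N: "\<And>s. N \<le> s \<Longrightarrow> 1 + 495 * exp (- (3 / 20) * s) < (20 :: real)"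
    by (auto simp: eventually_at_top_linorder)
  define T where "T = max N 0"
  have "continuous_on {0..T} (\<lambda>s. (\<lambda>(s, r). chilled t1 d s r) (s, r))"
    by (rule continuous_on_compose2[OF heat_sol_continuous[OF chilled_sol[OF td, of T]]])
      (use r in \<open>auto intro!: continuous_intros\<close>)
  then have "continuous_on {0..T} (\<lambda>s. chilled t1 d s r)" by simp
  then obtain s where s: "s \<in> {0..T}" "\<And>s'. s' \<in> {0..T} \<Longrightarrow> chilled t1 d s' r \<le> chilled t1 d s r"
    using continuous_attains_sup[of "{0..T}" "\<lambda>s. chilled t1 d s r"] by (auto simp: T_def)
  have "20 \<le> chilled t1 d 0 r" using boil_ge[OF td, of "t1 + d" r] td r by (simp add: chilled_def)
  then have 20: "20 \<le> chilled t1 d s r" using s(2)[of 0] by (auto simp: T_def)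
  show thesis
  proof
    show "0 \<le> s" using s(1) by simp
    fix s' :: real assume s': "0 \<le> s'"
    show "chilled t1 d s' r \<le> chilled t1 d s r"
    proof (cases "s' \<le> T")
      case False
      then have "N \<le> s'" by (simp add: T_def)
      then show ?thesis using chilled_decay[OF td s' r] N[of s'] 20 by linarith
    qed (use s s' in auto)
  qed
qed

definition peak :: "real \<Rightarrow> real \<Rightarrow> real \<Rightarrow> real" where
  "peak r t1 d = (SUP s\<in>{0..}. chilled t1 d s r)"

lemma peak:
  assumes "0 \<le> t1" "0 < d" "r \<in> {0..2}"
  shows peak_upper: "0 \<le> s \<Longrightarrow> chilled t1 d s r \<le> peak r t1 d"
    and peak_attained: "\<exists>s\<ge>0. chilled t1 d s r = peak r t1 d"
proof -
  obtain s0 where s0: "0 \<le> s0" "\<And>s'. 0 \<le> s' \<Longrightarrow> chilled t1 d s' r \<le> chilled t1 d s0 r"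
    using chilled_attains_max[OF assms] by blast
  then have "peak r t1 d = chilled t1 d s0 r"
    unfolding peak_def by (intro cSup_eq_maximum) auto
  then show "0 \<le> s \<Longrightarrow> chilled t1 d s r \<le> peak r t1 d" "\<exists>s\<ge>0. chilled t1 d s r = peak r t1 d"
    using s0 by auto
qed

lemma peak_le:
  assumes "0 \<le> t1" "0 < d" "r \<in> {0..2}" "\<And>s. 0 \<le> s \<Longrightarrow> chilled t1 d s r \<le> c"
  shows "peak r t1 d \<le> c"
  using peak_attained[OF assms(1-3)] assms(4) by metis

lemma peak_mono:
  assumes "0 \<le> t1" "t1 \<le> t1'" "0 < d" "d \<le> d'" "r \<in> {0..2}"
  shows "peak r t1 d \<le> peak r t1' d'"
proof (rule peak_le)
  show "chilled t1 d s r \<le> peak r t1' d'" if "0 \<le> s" for s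
    using chilled_mono[OF assms(1-4) that assms(5)] peak_upper[of t1' d' r s] assms that by auto
qed (use assms in auto)

text \<open>It suffices to compare the states at the end of the boiling: contraction carries the
  bound uniformly in time through the chill, hence to the supremum.\<close>

lemma peak_continuous:
  assumes td: "0 \<le> t1" "0 < d" and r: "r \<in> {0..2}" and e: "0 < e"
  obtains \<delta> where "0 < \<delta>" "\<And>t1' d'. 0 \<le> t1' \<Longrightarrow> 0 < d' \<Longrightarrow> \<bar>t1' - t1\<bar> < \<delta> \<Longrightarrow> \<bar>d' - d\<bar> < \<delta> \<Longrightarrow>
    \<bar>peak r t1' d' - peak r t1 d\<bar> \<le> e"
proof -
  \<comment> \<open>Reference eggs kept one unit longer in the respective bath. Nearby phase lengths
    are then moments of one solution, whose uniform continuity applies.\<close>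
  let ?v = "u (t1 + 1) 1" and ?w = "u t1 (d + 1)"
  obtain \<delta>1 where \<delta>1: "0 < \<delta>1" "\<And>s t r. s \<in> {0..t1 + 1} \<Longrightarrow> t \<in> {0..t1 + 1} \<Longrightarrow> \<bar>s - t\<bar> < \<delta>1 \<Longrightarrow> r \<in> {0..2} \<Longrightarrow>
     \<bar>?v s r - ?v t r\<bar> < e / 2"
    using heat_sol_uniform_continuity[OF warm[of "t1 + 1" 1], of "e / 2"] td e by auto
  obtain \<delta>2 where \<delta>2: "0 < \<delta>2" "\<And>s t r. s \<in> {t1..t1 + (d + 1)} \<Longrightarrow> t \<in> {t1..t1 + (d + 1)} \<Longrightarrow> \<bar>s - t\<bar> < \<delta>2 \<Longrightarrow>
     r \<in> {0..2} \<Longrightarrow> \<bar>?w s r - ?w t r\<bar> < e / 2"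
    using heat_sol_uniform_continuity[OF boil[of t1 "d + 1"], of "e / 2"] td e by auto
  show thesis
  proof (rule that[of "Min {\<delta>1, \<delta>2, 1}"])
    show "0 < Min {\<delta>1, \<delta>2, 1}" using \<delta>1(1) \<delta>2(1) by simp
    fix t1' d' assume td': "0 \<le> t1'" "0 < d'"
      and "\<bar>t1' - t1\<bar> < Min {\<delta>1, \<delta>2, 1}" "\<bar>d' - d\<bar> < Min {\<delta>1, \<delta>2, 1}"
    then have near: "\<bar>t1' - t1\<bar> < \<delta>1" "t1' \<le> t1 + 1" "\<bar>d' - d\<bar> < \<delta>2" "d' \<le> d + 1" by auto
    have start: "\<bar>u t1' d' (t1' + 0) r - ?w (t1 + 0) r\<bar> \<le> e / 2" if "r \<in> {0..2}" for r
      using warm_unique[of t1' d' "t1 + 1" 1 t1' r] warm_unique[of t1 "d + 1" "t1 + 1" 1 t1 r]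
        \<delta>1(2)[of t1' t1 r] near td td' that by auto
    have "\<bar>chilled t1' d' 0 r - chilled t1 d 0 r\<bar> \<le> e" if r: "r \<in> {0..2}" for r
    proof -
      have "heat_sol 0 d' 100 (\<lambda>s. u t1' d' (t1' + s))" "heat_sol 0 d' 100 (\<lambda>s. ?w (t1 + s))"
        using boil_sol[of t1' d'] heat_sol_subset[OF boil_sol[of t1 "d + 1"], of 0 d'] td td' near by simp_all
      then have "\<bar>u t1' d' (t1' + d') r - ?w (t1 + d') r\<bar> \<le> e / 2"
        using heat_sol_contraction[of 0 d' 100 "\<lambda>s. u t1' d' (t1' + s)" "\<lambda>s. ?w (t1 + s)" "e / 2" d' r]
          start td' e r by simp
      moreover have "\<bar>?w (t1 + d') r - ?w (t1 + d) r\<bar> < e / 2"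
        by (rule \<delta>2(2)) (use td td' near r in auto)
      moreover have "?w (t1 + d) r = u t1 d (t1 + d) r"
        using boil_unique[of t1 d "d + 1" d r] td r by simp
      ultimately have "\<bar>u t1' d' (t1' + d') r - u t1 d (t1 + d) r\<bar> \<le> e" by linarith
      then show ?thesis by (simp add: chilled_def)
    qed
    then have close: "\<bar>chilled t1' d' s r - chilled t1 d s r\<bar> \<le> e" if "0 \<le> s" for s
      using heat_sol_contraction[OF chilled_sol[of t1' d' s] chilled_sol[of t1 d s], of e s r] td td' e r that by auto
    have "peak r t1' d' \<le> peak r t1 d + e"
      by (rule peak_le[OF td' r]) (use close peak_upper[OF td r] in \<open>smt (verit)\<close>)
    moreover have "peak r t1 d \<le> peak r t1' d' + e"
      by (rule peak_le[OF td r]) (use close peak_upper[OF td' r] in \<open>smt (verit)\<close>)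
    ultimately show "\<bar>peak r t1' d' - peak r t1 d\<bar> \<le> e" by linarith
  qed
qed

lemma continuous_on_peak:
  assumes S: "S \<subseteq> {0..} \<times> {0<..}" and r: "r \<in> {0..2}"
  shows "continuous_on S (\<lambda>p. peak r (fst p) (snd p))"
  unfolding continuous_on_iff
proof (intro ballI allI impI)
  fix p :: "real \<times> real" and e :: real assume p: "p \<in> S" and e: "0 < e"
  have td: "0 \<le> fst p" "0 < snd p" using p S by auto
  obtain \<delta> where \<delta>: "0 < \<delta>" "\<And>t1' d'. 0 \<le> t1' \<Longrightarrow> 0 < d' \<Longrightarrow> \<bar>t1' - fst p\<bar> < \<delta> \<Longrightarrow> \<bar>d' - snd p\<bar> < \<delta> \<Longrightarrow>
    \<bar>peak r t1' d' - peak r (fst p) (snd p)\<bar> \<le> e / 2"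
    using peak_continuous[OF td r, of "e / 2"] e by auto
  show "\<exists>\<delta>>0. \<forall>p'\<in>S. dist p' p < \<delta> \<longrightarrow> dist (peak r (fst p') (snd p')) (peak r (fst p) (snd p)) < e"
  proof (intro exI[of _ \<delta>] conjI ballI impI)
    fix p' assume p': "p' \<in> S" "dist p' p < \<delta>"
    have "\<bar>fst p' - fst p\<bar> < \<delta>" "\<bar>snd p' - snd p\<bar> < \<delta>"
      using dist_fst_le[of p' p] dist_snd_le[of p' p] p'(2) by (auto simp: dist_real_def)
    then have "\<bar>peak r (fst p') (snd p') - peak r (fst p) (snd p)\<bar> \<le> e / 2"
      using \<delta>(2)[of "fst p'" "snd p'"] p'(1) S by auto
    then show "dist (peak r (fst p') (snd p')) (peak r (fst p) (snd p)) < e"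
      using e by (simp add: dist_real_def)
  qed (rule \<delta>(1))
qed

text \<open>Brouwer's theorem for \<open>(t1, d) \<mapsto> (t1 + 65 - Y, d + 85 - W)\<close>, clamped to the rectangle. As the peaks are
  monotone, the two opposite corners control the clamping on all four sides.\<close>

lemma peaks_at_targets:
  assumes T: "0 \<le> T" and d01: "0 < d0" "d0 \<le> d1"
    and A: "85 \<le> peak (7 / 4) 0 d1" "peak 0 0 d1 < 65"
    and B: "peak (7 / 4) T d0 \<le> 85" "65 \<le> peak 0 T d0"
  obtains t1 d where "0 < t1" "0 < d" "peak (7 / 4) t1 d = 85" "peak 0 t1 d = 65"
proof -
  let ?S = "{0..T} \<times> {d0..d1}"
  define F where "F p = (max 0 (min T (fst p + (65 - peak 0 (fst p) (snd p)))),
    max d0 (min d1 (snd p + (85 - peak (7 / 4) (fst p) (snd p)))))" for p :: "real \<times> real"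
  obtain p where p: "p \<in> ?S" "F p = p"
  proof (rule brouwer[of ?S F])
    show "compact ?S" by (intro compact_Times compact_Icc)
    show "convex ?S" by (intro convex_Times convex_real_interval)
    show "?S \<noteq> {}" using T d01 by auto
    show "F \<in> ?S \<rightarrow> ?S" using T d01 by (auto simp: F_def)
    show "continuous_on ?S F"
      unfolding F_def by (intro continuous_intros continuous_on_peak) (use d01 in auto)
  qed
  obtain t1 d where td: "p = (t1, d)" by (cases p)
  have rect: "0 \<le> t1" "t1 \<le> T" "d0 \<le> d" "d \<le> d1" using p td by auto
  have fp: "max 0 (min T (t1 + (65 - peak 0 t1 d))) = t1" "max d0 (min d1 (d + (85 - peak (7 / 4) t1 d))) = d"
    using p(2) unfolding F_def td by auto
  have Y0: "peak 0 0 d < 65" using peak_mono[of 0 0 d d1 0] A(2) rect d01 by auto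
  have YT: "65 \<le> peak 0 T d" using peak_mono[of T T d0 d 0] B(2) rect d01 T by auto
  have W0: "peak (7 / 4) t1 d0 \<le> 85" using peak_mono[of t1 T d0 d0 "7 / 4"] B(1) rect d01 by auto
  have W1: "85 \<le> peak (7 / 4) t1 d1" using peak_mono[of 0 t1 d1 d1 "7 / 4"] A(1) rect d01 by auto
  have Y: "peak 0 t1 d = 65"
  \<comment> \<open>An error survives at a fixed point only if the clamping absorbs it: too cold a
    centre forces \<open>t1 = T\<close>, too hot a centre \<open>t1 = 0\<close>, and the values on
    these sides exclude both.\<close>
  proof (rule ccontr)
    assume "peak 0 t1 d \<noteq> 65"
    then have "(t1 = T \<and> peak 0 t1 d < 65) \<or> (t1 = 0 \<and> 65 < peak 0 t1 d)"
      using fp(1) T by (auto simp: max_def min_def split: if_splits)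
    then show False using Y0 YT by auto
  qed
  have W: "peak (7 / 4) t1 d = 85"
  proof (rule ccontr)
    assume "peak (7 / 4) t1 d \<noteq> 85"
    then have "(d = d1 \<and> peak (7 / 4) t1 d < 85) \<or> (d = d0 \<and> 85 < peak (7 / 4) t1 d)"
      using fp(2) d01 by (auto simp: max_def min_def split: if_splits)
    then show False using W0 W1 by auto
  qed
  \<comment> \<open>The strict inequality in corner \<open>A\<close> is what makes the first phase
    nonempty.\<close>
  have "t1 \<noteq> 0" using Y Y0 by auto
  then show thesis using that[of t1 d] rect d01 Y W by auto
qed

end

section \<open>Estimates at the two corners\<close>

lemma cubic_decreasing:
  fixes a p :: real
  assumes "0 \<le> a" "a \<le> p" "p \<le> 11 / 20"
  shows "- 1633113 * p + 745183 * p ^ 3 \<le> - 1633113 * a + 745183 * a ^ 3"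
proof -
  have "p * p \<le> 11 / 20 * (11 / 20)" "p * a \<le> 11 / 20 * (11 / 20)" "a * a \<le> 11 / 20 * (11 / 20)"
    using assms by (intro mult_mono; simp)+
  then have "0 \<le> (p - a) * (1633113 - 745183 * (p * p + p * a + a * a))"
    using assms by (intro mult_nonneg_nonneg) auto
  then show ?thesis by (simp add: algebra_simps power3_eq_cube)
qed

lemma cooling_below_centre_le:
  assumes "0 \<le> a" "a \<le> p" "p \<le> 11 / 20"
  shows "cooling_below p 0 \<le> - 1633113 * a + 745183 * a ^ 3"
proof -
  have "0 \<le> p ^ 6" by simp
  then have "cooling_below p 0 \<le> - 1633113 * p + 745183 * p ^ 3"
    unfolding cooling_below_centre by linarith
  then show ?thesis using cubic_decreasing[OF assms] by linarith
qed

text \<open>Subtracted from 100 this is the upper bound 65 + 15 (r - 1)^30 + 2400 (t - a). The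
  exponent makes the surface slope 450, enough for the Robin condition as 26 * 450 > 550 * 20; 2400
  dominates 17/100 * (13050 + 900). After time 1/480 the bound is at most 65 + 15 + 5 = 85.\<close>

lemma subsol_edge_layer:
  "subsol a b (\<lambda>t r. if r < 1 then 35 - 2400 * (t - a) else 35 - 15 * (r - 1) ^ 30 - 2400 * (t - a))"
proof (rule subsol_pieces[where gr = "\<lambda>_ _. 0" and grr = "\<lambda>_ _. 0" and gt = "\<lambda>_ _. - 2400"
      and wr = "\<lambda>t r. - 450 * (r - 1) ^ 29" and wrr = "\<lambda>t r. - 13050 * (r - 1) ^ 28" and wt = "\<lambda>_ _. - 2400"])
  fix t r :: real assume r: "r \<in> {1<..<2}"
  then have "(r - 1) ^ 28 \<le> 1" "(r - 1) ^ 29 \<le> 1" "2 / r \<le> 2" by (auto intro!: power_le_one simp: field_simps)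
  moreover from this have "2 / r * (r - 1) ^ 29 \<le> 2 * 1" using r by (intro mult_mono) auto
  ultimately show "- 2400 \<le> 17 / 100 * (- 13050 * (r - 1) ^ 28 + 2 / r * (- 450 * (r - 1) ^ 29))"
    by (simp add: algebra_simps)
qed (auto intro!: continuous_intros derivative_eq_intros simp: case_prod_beta)

text \<open>An exponential front moving inwards with speed 13/100 * \<beta>, set by the smaller
  diffusivity. All its radial derivatives are nonnegative, so the larger diffusivity, the term 2/r
  and the interface only help; the last hypothesis secures the Robin condition.\<close>

lemma subsol_exponential_front:
  assumes "0 \<le> \<beta>" "0 \<le> \<epsilon>" "\<epsilon> * (26 * \<beta> + 550) * exp (2 * \<beta> + 13 / 100 * \<beta>\<^sup>2 * (b - a)) \<le> 550 * c"
  shows "subsol a b (\<lambda>t r. \<epsilon> * (exp (\<beta> * r + 13 / 100 * \<beta>\<^sup>2 * (t - a)) - exp (2 * \<beta>)) - c)"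
proof -
  let ?e = "\<lambda>t r. exp (\<beta> * r + 13 / 100 * \<beta>\<^sup>2 * (t - a))"
  let ?f = "\<lambda>t r. \<epsilon> * (?e t r - exp (2 * \<beta>)) - c"
  have "subsol a b (\<lambda>t r. if r < 1 then ?f t r else ?f t r)"
  proof (rule subsol_pieces[where gr = "\<lambda>t r. \<epsilon> * \<beta> * ?e t r" and wr = "\<lambda>t r. \<epsilon> * \<beta> * ?e t r"
        and grr = "\<lambda>t r. \<epsilon> * \<beta>\<^sup>2 * ?e t r" and wrr = "\<lambda>t r. \<epsilon> * \<beta>\<^sup>2 * ?e t r"
        and gt = "\<lambda>t r. 13 / 100 * (\<epsilon> * \<beta>\<^sup>2 * ?e t r)" and wt = "\<lambda>t r. 13 / 100 * (\<epsilon> * \<beta>\<^sup>2 * ?e t r)"])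
    fix t assume t: "t \<in> {a<..<b}"
    have "13 / 100 * \<beta>\<^sup>2 * (t - a) \<le> 13 / 100 * \<beta>\<^sup>2 * (b - a)" using t by (intro mult_left_mono) auto
    then have "?e t 2 \<le> exp (2 * \<beta> + 13 / 100 * \<beta>\<^sup>2 * (b - a))" unfolding exp_le_cancel_iff by linarith
    then have "\<epsilon> * (26 * \<beta> + 550) * ?e t 2 \<le> \<epsilon> * (26 * \<beta> + 550) * exp (2 * \<beta> + 13 / 100 * \<beta>\<^sup>2 * (b - a))"
      using assms by (intro mult_left_mono) auto
    also have "\<dots> \<le> 550 * c" by (rule assms(3))
    finally have "\<epsilon> * (26 * \<beta> + 550) * ?e t 2 \<le> 550 * c" .
    moreover have "0 \<le> \<epsilon> * exp (2 * \<beta>)" using assms by simp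
    ultimately show "26 * (\<epsilon> * \<beta> * ?e t 2) + 550 * ?f t 2 \<le> 0" by (simp add: algebra_simps)
    have "0 \<le> \<epsilon> * \<beta> * ?e t 1" using assms by simp
    then show "17 * (\<epsilon> * \<beta> * ?e t 1) \<le> 26 * (\<epsilon> * \<beta> * ?e t 1)" by linarith
    fix r :: real
    have nn: "0 \<le> \<epsilon> * \<beta>\<^sup>2 * ?e t r" "0 < r \<Longrightarrow> 0 \<le> 2 / r * (\<epsilon> * \<beta> * ?e t r)" using assms by simp_all
    then show "13 / 100 * (\<epsilon> * \<beta>\<^sup>2 * ?e t r) \<le> 13 / 100 * (\<epsilon> * \<beta>\<^sup>2 * ?e t r + 2 / r * (\<epsilon> * \<beta> * ?e t r))"
      if "r \<in> {0<..<1}" using that by simp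
    show "13 / 100 * (\<epsilon> * \<beta>\<^sup>2 * ?e t r) \<le> 17 / 100 * (\<epsilon> * \<beta>\<^sup>2 * ?e t r + 2 / r * (\<epsilon> * \<beta> * ?e t r))"
      if "r \<in> {1<..<2}" using nn that by (intro mult_mono) auto
  qed (auto intro!: continuous_intros derivative_eq_intros simp: case_prod_beta power2_eq_square)
  then show ?thesis by simp
qed

context egg_family
begin

lemma boil_from_start: "heat_sol 0 (21 / 10) 100 (u 0 (21 / 10))"
  using boil[of 0 "21 / 10"] by simp

text \<open>The peak is at least the temperature at the first instant of the chill, so only the
  boiling matters. The factor 12500 scales the initial gap 80 to 10^6, and 187500 = 12500 *
  15.\<close>

lemma white_overcooked: "85 \<le> peak (7 / 4) 0 (21 / 10)"
proof -
  let ?f = "\<lambda>t r. 12500 * (100 - u 0 (21 / 10) t r)"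
  let ?q = "exp (- (2 / 5) * (21 / 10 - 13 / 20)) :: real"
  have "subsol 0 (21 / 10) ?f"
    using boil_from_start by (intro subsol_scale) (auto simp: heat_sol_def)
  then have "?f (21 / 10) (7 / 4) \<le> exp_profile (exp (- (of_int 2 / of_int 5) * (21 / 10 - 13 / 20)))
      cool_above_exp1 cool_above_exp2 (last cool_above) (7 / 4)"
    by (rule subsol_le_chain_exp[OF _ cool_above_ok]) (use initial[of 0 "21 / 10"] in auto)
  then have "?f (21 / 10) (7 / 4) \<le> cooling_above ?q (7 / 4)" by (simp add: cooling_above_def)
  also have "\<dots> \<le> 290008 * ?q + 90319 * ?q ^ 3 + 90096 * ?q ^ 6"
    by (rule cooling_above_white) simp
  also have "\<dots> \<le> 290008 * (57 / 100) + 90319 * (57 / 100) ^ 3 + 90096 * (57 / 100) ^ 6"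
  proof -
    have "?q \<le> 57 / 100" using exp_bounds(1) by simp
    then show ?thesis by (intro add_mono mult_left_mono power_mono) auto
  qed
  also have "\<dots> \<le> 187500" by (simp add: power_divide)
  finally have "85 \<le> chilled 0 (21 / 10) 0 (7 / 4)" by (simp add: chilled_def)
  then show ?thesis using peak_upper[of 0 "21 / 10" "7 / 4" 0] by simp
qed

text \<open>The barrier for the boiling remains valid during the chill: a colder bath only lowers
  the temperature, formally because \<open>u - 100 = (u - 1) + - 99\<close>.\<close>

lemma heating_bound:
  assumes t: "21 / 10 \<le> t" and r: "r \<in> {0..2}"
  shows "12500 * (u 0 (21 / 10) t r - 100) \<le> cooling_below (exp (- (21 / 50) * (t - 13 / 20))) r"
proof -
  let ?f = "\<lambda>t r. 12500 * (u 0 (21 / 10) t r - 100)"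
  have first: "?f (21 / 10) r \<le> exp_profile (exp (- (of_int 21 / of_int 50) * (21 / 10 - 13 / 20)))
      cool_below_exp1 cool_below_exp2 (last cool_below) r" if "r \<in> {0..2}" for r
  proof (rule subsol_le_chain_exp[OF _ cool_below_ok _ _ _ _ that, where f = ?f and a = 0 and b = "21 / 10"])
    show "subsol 0 (21 / 10) ?f"
      using boil_from_start by (intro subsol_scale) (auto simp: heat_sol_def)
  qed (use initial[of 0 "21 / 10"] in auto)
  have "subsol (21 / 10) t (\<lambda>t r. 12500 * ((u 0 (21 / 10) t r - 1) + - 99))"
    using chill[of 0 "21 / 10" t] by (intro subsol_scale subsol_add subsol_const) (auto simp: heat_sol_def)
  moreover have "(\<lambda>t r. 12500 * ((u 0 (21 / 10) t r - 1) + - 99)) = ?f" by simp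
  ultimately have "subsol (21 / 10) t ?f" by (simp only:)
  then have "?f t r \<le> exp_profile (exp (- (of_int 21 / of_int 50) * (t - 13 / 20)))
      cool_below_exp1 cool_below_exp2 (last cool_below) r"
  proof (rule subsol_le_exp_profile[where f = ?f and a = "21 / 10" and b = t])
    show "exp_ok 21 50 cool_below_exp1 cool_below_exp2 (last cool_below)" by (rule cool_below_ok)
  qed (use t r first in simp_all)
  then show ?thesis by (simp add: cooling_below_def)
qed

text \<open>The chilled egg is a superposition of heating by 80 from time 0 on and of cooling by 99 from time
  \<open>21 / 10\<close> on.\<close>

lemma chilling_bound:
  assumes t: "11 / 4 \<le> t" and r: "r \<in> {0..2}"
  shows "1000000 * (u 0 (21 / 10) t r - 1) \<le> 80 * cooling_below (exp (- (21 / 50) * (t - 13 / 20))) r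
    + 99 * cooling_above (exp (- (2 / 5) * (t - 11 / 4))) r"
proof -
  let ?b = "\<lambda>t r. cooling_below (exp (- (21 / 50) * (t - 13 / 20))) r"
  \<comment> \<open>By \<open>heating_bound\<close> the remainder after removing the heating part is
    at most 99 * 10^6 at time 21/10. Division by 99 normalises it for \<open>cool_above\<close>,
    whose exponential form starts at 21/10 + 13/20 = 11/4.\<close>
  let ?f = "\<lambda>t r. 1 / 99 * (1000000 * (u 0 (21 / 10) t r - 1) + 80 * - ?b t r)"
  have "subsol (13 / 20) t (\<lambda>t r. - ?b t r)"
    using subsol_exp_profiles[OF cool_below_ok(2), of "13 / 20" t]
    by (simp add: cooling_below_def exp_profile_def)
  then have "subsol (21 / 10) t (\<lambda>t r. - ?b t r)" by (rule subsol_subset) auto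
  then have "subsol (21 / 10) t ?f"
    using chill[of 0 "21 / 10" t] by (intro subsol_scale subsol_add) (auto simp: heat_sol_def)
  then have "?f t r \<le> exp_profile (exp (- (of_int 2 / of_int 5) * (t - 11 / 4)))
      cool_above_exp1 cool_above_exp2 (last cool_above) r"
  proof (rule subsol_le_chain_exp[OF _ cool_above_ok])
    show "?f (21 / 10) r \<le> of_int 1000000" if "r \<in> {0..2}" for r
      using heating_bound[of "21 / 10" r] that by simp
  qed (use t r in auto)
  then show ?thesis by (simp add: cooling_above_def)
qed

lemma centre_undercooked: "peak 0 0 (21 / 10) < 65"
proof -
  have "u 0 (21 / 10) t 0 < 65" if t: "21 / 10 \<le> t" for t
  \<comment> \<open>Up to 73/20 the heating bound alone stays below 65. Afterwards \<open>?s\<close>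
    is at most 6856/10000, which keeps 3/100 + 977/1000 * \<open>?s\<close> below 7/10, the range
    where \<open>cooling_above\<close> is known to increase at the centre.\<close>
  proof (cases "t \<le> 73 / 20")
    case True
    let ?p = "exp (- (21 / 50) * (t - 13 / 20))"
    have "exp (- (63 / 50)) \<le> ?p" "?p \<le> exp (- (609 / 1000))" using t True by simp_all
    then have "279 / 1000 \<le> ?p" "?p \<le> 11 / 20" using exp_bounds(2,7) by linarith+
    then have "cooling_below ?p 0 \<le> - 1633113 * (279 / 1000) + 745183 * (279 / 1000) ^ 3"
      by (intro cooling_below_centre_le) auto
    then show ?thesis using heating_bound[OF t, of 0] by (simp add: power_divide)
  next
    case False
    define x where "x = t - 11 / 4"
    let ?s = "exp (- (21 / 50) * x)" and ?p = "exp (- (21 / 50) * (t - 13 / 20))" and ?q = "exp (- (2 / 5) * x)"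
    have "?s \<le> exp (- (189 / 500))" using False by (simp add: x_def)
    then have s: "0 \<le> ?s" "?s \<le> 6856 / 10000" using exp_bounds(6) by (simp, linarith)
    have p: "?p = exp (- (441 / 500)) * ?s"
      unfolding exp_add[symmetric] by (simp add: x_def field_simps)
    define A where "A = cooling_above (3 / 100 + 977 / 1000 * ?s) 0"
    define B where "B = - 1633113 * (411 / 1000 * ?s) + 745183 * (411 / 1000 * ?s) ^ 3"
    have "cooling_above ?q 0 \<le> A"
      unfolding A_def using exp_mix_le[of x] s by (intro cooling_above_centre_mono) auto
    moreover have "cooling_below ?p 0 \<le> B"
      unfolding B_def
    proof (rule cooling_below_centre_le)
      show "411 / 1000 * ?s \<le> ?p" unfolding p using exp_bounds(3) by (intro mult_right_mono) auto
      have "?p \<le> exp (- (609 / 1000))" using False by simp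
      then show "?p \<le> 11 / 20" using exp_bounds(7) by linarith
    qed simp
    moreover have "1000000 * (u 0 (21 / 10) t 0 - 1) \<le> 80 * cooling_below ?p 0 + 99 * cooling_above ?q 0"
      using chilling_bound[of t 0] False by (simp add: x_def)
    moreover have "80 * B + 99 * A < 64000000"
      unfolding A_def B_def by (rule peak_polynomial) (use s in linarith)+
    ultimately show ?thesis by argo
  qed
  moreover obtain s where "0 \<le> s" "chilled 0 (21 / 10) s 0 = peak 0 0 (21 / 10)"
    using peak_attained[of 0 "21 / 10" 0] by auto
  ultimately show ?thesis by (metis add_0 chilled_def le_add_same_cancel1)
qed

lemma white_stays_below:
  assumes T: "0 \<le> T"
  shows "peak (7 / 4) T (1 / 480) \<le> 85"
proof (rule peak_le)
  have "u T (1 / 480) (T + 1 / 480) r \<le> 85" if r: "r \<in> {0..2}" for r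
  proof -
    let ?g = "\<lambda>t r. if r < 1 then 35 - 2400 * (t - T) else 35 - 15 * (r - 1) ^ 30 - 2400 * (t - T)"
    have "subsol T (T + 1 / 480) (\<lambda>t r. (u T (1 / 480) t r - 100) + ?g t r)"
      using boil[OF T, of "1 / 480"] by (intro subsol_add subsol_edge_layer) (auto simp: heat_sol_def)
    then have "(u T (1 / 480) (T + 1 / 480) r - 100) + ?g (T + 1 / 480) r \<le> 0"
    proof (rule maximum_principle)
      show "(u T (1 / 480) T r - 100) + ?g T r \<le> 0" if "r \<in> {0..2}" for r
      proof -
        have "0 \<le> (r - 1) ^ 30" by simp
        then have "?g T r \<le> 35" by simp
        then show ?thesis using warm_le[of T "1 / 480" T r] T that by simp
      qed
    qed (use r in auto)
    moreover have "1 \<le> r \<Longrightarrow> (r - 1) ^ 30 \<le> 1" using r by (intro power_le_one) auto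
    ultimately show ?thesis by (cases "r < 1") auto
  qed
  then show "chilled T (1 / 480) s (7 / 4) \<le> 85" if "0 \<le> s" for s
    using heat_sol_le_const[OF chilled_sol[of T "1 / 480" s], of 85 s "7 / 4"] T that by (simp add: chilled_def)
qed (use T in auto)

lemma warm_near_bath:
  assumes "0 \<le> T" "0 < d" "r \<in> {0..2}"
  shows "65 - 225 * exp (- (3 / 20) * T) \<le> u T d T r"
  using subsol_le_decay[of 0 T "\<lambda>t r. 65 - u T d t r" 45 T r] warm[of T d] initial[of T d] assms
  by (simp add: heat_sol_def)

text \<open>However short the boiling phase, it warms the centre a little, because heat propagates with infinite speed.\<close>

lemma centre_overcooked:
  obtains T where "0 \<le> T" "65 \<le> peak 0 T (1 / 480)"
proof -
  \<comment> \<open>Large enough for the front to cross the whole radius 2 during the boiling: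
    13/100 * 7680 / 480 = 2.08.\<close>
  define \<beta> where "\<beta> = (7680 :: real)"
  define K where "K = exp (2 * \<beta> + 13 / 100 * \<beta>\<^sup>2 * (1 / 480))"
  \<comment> \<open>Small enough for the Robin condition: (26 * \<beta> + 550) / 20 is below 550 *
    35, where 35 = 100 - 65.\<close>
  define \<epsilon> where "\<epsilon> = 1 / 20 / K"
  \<comment> \<open>The guaranteed gain at the centre; \<open>T\<close> is then chosen so that the
    first phase leaves a deficit smaller than this.\<close>
  define G where "G = \<epsilon> * (exp (13 / 100 * \<beta>\<^sup>2 * (1 / 480)) - exp (2 * \<beta>))"
  have \<epsilon>: "0 < \<epsilon>" "\<epsilon> * K = 1 / 20" by (simp_all add: \<epsilon>_def K_def)
  have "2 * \<beta> < 13 / 100 * \<beta>\<^sup>2 * (1 / 480)" by (simp add: \<beta>_def power2_eq_square)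
  then have G: "0 < G" using \<epsilon> unfolding G_def by (intro mult_pos_pos) auto
  have "((\<lambda>T::real. 225 * exp (- (3 / 20) * T)) \<longlongrightarrow> 225 * 0) at_top"
    by (intro tendsto_intros filterlim_compose[OF exp_at_bot]
        filterlim_tendsto_neg_mult_at_bot[OF tendsto_const _ filterlim_ident]) auto
  then have "\<forall>\<^sub>F T in at_top. 225 * exp (- (3 / 20) * T) < G"
    by (rule order_tendstoD) (use G in simp)
  then obtain N where N: "\<And>T. N \<le> T \<Longrightarrow> 225 * exp (- (3 / 20) * T) < G"
    by (auto simp: eventually_at_top_linorder)
  define T where "T = max 0 N"
  have T: "0 \<le> T" "225 * exp (- (3 / 20) * T) < G" using N[of T] by (auto simp: T_def)
  let ?g = "\<lambda>t r. \<epsilon> * (exp (\<beta> * r + 13 / 100 * \<beta>\<^sup>2 * (t - T)) - exp (2 * \<beta>)) - (35 + G)"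
  have "subsol T (T + 1 / 480) ?g"
  proof (rule subsol_exponential_front)
    have "\<epsilon> * (26 * \<beta> + 550) * exp (2 * \<beta> + 13 / 100 * \<beta>\<^sup>2 * (T + 1 / 480 - T)) = (26 * \<beta> + 550) * (\<epsilon> * K)"
      by (simp add: K_def)
    also have "\<dots> \<le> 550 * (35 + G)" unfolding \<epsilon>(2) using G by (simp add: \<beta>_def)
    finally show "\<epsilon> * (26 * \<beta> + 550) * exp (2 * \<beta> + 13 / 100 * \<beta>\<^sup>2 * (T + 1 / 480 - T)) \<le> 550 * (35 + G)" .
  qed (use \<epsilon> in \<open>auto simp: \<beta>_def\<close>)
  then have "subsol T (T + 1 / 480) (\<lambda>t r. (100 - u T (1 / 480) t r) + ?g t r)"
    using boil[OF T(1), of "1 / 480"] by (intro subsol_add) (auto simp: heat_sol_def)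
  then have "(100 - u T (1 / 480) (T + 1 / 480) 0) + ?g (T + 1 / 480) 0 \<le> 0"
  proof (rule maximum_principle)
    show "(100 - u T (1 / 480) T r) + ?g T r \<le> 0" if r: "r \<in> {0..2}" for r
    proof -
      have "exp (\<beta> * r) \<le> exp (2 * \<beta>)" using r by (simp add: \<beta>_def)
      then have "\<epsilon> * (exp (\<beta> * r) - exp (2 * \<beta>)) \<le> 0" using \<epsilon> by (intro mult_nonneg_nonpos) auto
      then show ?thesis using warm_near_bath[OF T(1) _ r, of "1 / 480"] T(2) by simp
    qed
  qed auto
  then have "65 \<le> chilled T (1 / 480) 0 0" by (simp add: chilled_def G_def)
  then have "65 \<le> peak 0 T (1 / 480)" using peak_upper[of T "1 / 480" 0 0] T(1) by simp
  then show thesis using that[OF T(1)] by blast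
qed

lemma targets_attained:
  obtains t1 d where "0 < t1" "0 < d" "peak (7 / 4) t1 d = 85" "peak 0 t1 d = 65"
proof -
  obtain T where "0 \<le> T" "65 \<le> peak 0 T (1 / 480)" by (rule centre_overcooked)
  then show thesis
    using peaks_at_targets[of T "1 / 480" "21 / 10"] white_overcooked centre_undercooked white_stays_below[of T] that
    by auto
qed

end

section \<open>Passage to dimensionless variables and conclusion\<close>

definition rescale :: "(real \<Rightarrow> real \<Rightarrow> real) \<Rightarrow> (real \<Rightarrow> real \<Rightarrow> real) \<Rightarrow> real \<Rightarrow> real \<Rightarrow> real" where
  "rescale uY uW t r = (if r < 1 then uY (121 * t) (11 / 1000 * r) else uW (121 * t) (11 / 1000 * r))"

text \<open>The factor 10^6 is 121 / (11/1000)^2, from one time and two space derivatives.\<close>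

lemma radial_heat_eq_rescale:
  assumes eq: "radial_heat_eq \<alpha> p q w" and t: "0 < t"
  obtains v where "\<And>r. 11 / 1000 * r \<in> {p<..<q} \<Longrightarrow>
      ((\<lambda>r. w (121 * t) (11 / 1000 * r)) has_real_derivative v r) (at r)"
    and "\<And>r. 11 / 1000 * r \<in> {p<..<q} \<Longrightarrow> \<exists>D. ((\<lambda>x. x\<^sup>2 * v x) has_real_derivative D) (at r) \<and>
      ((\<lambda>s. w (121 * s) (11 / 1000 * r)) has_real_derivative 1000000 * \<alpha> / r\<^sup>2 * D) (at t)"
proof -
  obtain v where "\<forall>t>0. \<forall>r\<in>{p<..<q}. ((\<lambda>x. w t x) has_real_derivative v t r) (at r) \<and>
      (\<exists>D. ((\<lambda>x. x\<^sup>2 * v t x) has_real_derivative D) (at r) \<and>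
           ((\<lambda>s. w s r) has_real_derivative \<alpha> / r\<^sup>2 * D) (at t))"
    using eq unfolding radial_heat_eq_def by (rule exE)
  then have v: "\<And>t r. 0 < t \<Longrightarrow> r \<in> {p<..<q} \<Longrightarrow> (w t has_real_derivative v t r) (at r)"
    and D: "\<And>t r. 0 < t \<Longrightarrow> r \<in> {p<..<q} \<Longrightarrow> \<exists>D. ((\<lambda>x. x\<^sup>2 * v t x) has_real_derivative D) (at r) \<and>
           ((\<lambda>s. w s r) has_real_derivative \<alpha> / r\<^sup>2 * D) (at t)"
    by simp_all
  have t': "0 < 121 * t" using t by simp
  have lin: "((\<lambda>x. c * x) has_real_derivative c) (at x)" for c x :: real
    by (auto intro!: derivative_eq_intros)
  show thesis
  proof (rule that[of "\<lambda>r. v (121 * t) (11 / 1000 * r) * (11 / 1000)"])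
    fix r assume r: "11 / 1000 * r \<in> {p<..<q}"
    show "((\<lambda>r. w (121 * t) (11 / 1000 * r)) has_real_derivative v (121 * t) (11 / 1000 * r) * (11 / 1000)) (at r)"
      by (rule DERIV_chain'[OF lin v[OF t' r]])
    obtain D where D: "((\<lambda>x. x\<^sup>2 * v (121 * t) x) has_real_derivative D) (at (11 / 1000 * r))"
      "((\<lambda>s. w s (11 / 1000 * r)) has_real_derivative \<alpha> / (11 / 1000 * r)\<^sup>2 * D) (at (121 * t))"
      using D[OF t' r] by blast
    have "((\<lambda>x. 1000 / 11 * ((11 / 1000 * x)\<^sup>2 * v (121 * t) (11 / 1000 * x))) has_real_derivative
        1000 / 11 * (D * (11 / 1000))) (at r)"
      by (intro DERIV_cmult DERIV_chain'[OF lin D(1)])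
    then have "((\<lambda>x. x\<^sup>2 * (v (121 * t) (11 / 1000 * x) * (11 / 1000))) has_real_derivative D) (at r)"
      by (simp add: power_mult_distrib power2_eq_square mult_ac)
    moreover have "\<alpha> / (11 / 1000 * r)\<^sup>2 * D * 121 = 1000000 * \<alpha> / r\<^sup>2 * D"
      by (simp add: power_mult_distrib power_divide)
    then have "((\<lambda>s. w (121 * s) (11 / 1000 * r)) has_real_derivative 1000000 * \<alpha> / r\<^sup>2 * D) (at t)"
      using DERIV_chain'[OF lin D(2)] by (simp only:)
    ultimately show "\<exists>D. ((\<lambda>x. x\<^sup>2 * (v (121 * t) (11 / 1000 * x) * (11 / 1000))) has_real_derivative D) (at r) \<and>
      ((\<lambda>s. w (121 * s) (11 / 1000 * r)) has_real_derivative 1000000 * \<alpha> / r\<^sup>2 * D) (at t)"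
      by (intro exI conjI)
  qed
qed

lemma rescale_within:
  assumes "(f has_real_derivative D) (at (11 / 1000 * x) within {11 / 1000 * a..11 / 1000 * b})"
  shows "((\<lambda>r. f (11 / 1000 * r)) has_real_derivative 11 / 1000 * D) (at x within {a..b})"
proof -
  have "(f has_real_derivative D) (at (11 / 1000 * x) within ((\<lambda>r. 11 / 1000 * r) ` {a..b}))"
    by (rule has_field_derivative_subset[OF assms]) auto
  moreover have "((\<lambda>r. 11 / 1000 * r) has_real_derivative 11 / 1000) (at x within {a..b})"
    by (auto intro!: derivative_eq_intros)
  ultimately have "(f \<circ> (\<lambda>r. 11 / 1000 * r) has_real_derivative D * (11 / 1000)) (at x within {a..b})"
    by (rule DERIV_image_chain)
  then show ?thesis unfolding o_def by (subst mult.commute)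
qed

text \<open>The open interval avoids the switching times, where no Robin condition is assumed;
  continuity up to the end points joins the phases.\<close>

lemma heat_sol_rescale:
  fixes uY uW :: "real \<Rightarrow> real \<Rightarrow> real"
  assumes sol: "egg_solution 0.011 0.022 (1.3 / 10 ^ 7) (1.7 / 10 ^ 7) 0.34 0.52 1000 T0 Tw S uY uW"
    and "0 \<le> a" and phase: "\<And>t. t \<in> {a<..<b} \<Longrightarrow> 121 * t \<notin> S \<and> Tw (121 * t) = B"
  shows "heat_sol a b B (rescale uY uW)"
proof -
  let ?k = "\<lambda>r. 11 / 1000 * r :: real" and ?u = "rescale uY uW"
  have cY: "continuous_on ({0..} \<times> {0..0.011}) (\<lambda>(t, r). uY t r)"
    and cW: "continuous_on ({0..} \<times> {0.011..0.022}) (\<lambda>(t, r). uW t r)"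
    and eqY: "radial_heat_eq (1.3 / 10 ^ 7) 0 0.011 uY" and eqW: "radial_heat_eq (1.7 / 10 ^ 7) 0.011 0.022 uW"
    and iY: "\<And>r. r \<in> {0..0.011} \<Longrightarrow> uY 0 r = T0" and iW: "\<And>r. r \<in> {0.011..0.022} \<Longrightarrow> uW 0 r = T0"
    and join: "\<And>t. 0 < t \<Longrightarrow> uY t 0.011 = uW t 0.011"
    and flux: "\<And>t. 0 < t \<Longrightarrow> \<exists>DY DW. (uY t has_real_derivative DY) (at 0.011 within {0..0.011}) \<and>
                    (uW t has_real_derivative DW) (at 0.011 within {0.011..0.022}) \<and> 0.34 * DY = 0.52 * DW"
    and robin: "\<And>t. 0 < t \<Longrightarrow> t \<notin> S \<Longrightarrow>
        \<exists>D. (uW t has_real_derivative D) (at 0.022 within {0.011..0.022}) \<and>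
             - 0.52 * D = 1000 * (uW t 0.022 - Tw t)"
    using sol unfolding egg_solution_def by blast+
  \<comment> \<open>The interface condition is assumed for positive times only; at time 0 both sides
    equal \<open>T0\<close>.\<close>
  have join0: "uY t 0.011 = uW t 0.011" if "0 \<le> t" for t
    using join[of t] iY[of "0.011"] iW[of "0.011"] that by (cases "t = 0") auto
  have cont: "continuous_on ({a..b} \<times> {0..2}) (\<lambda>(t, r). ?u t r)"
  proof -
    have "continuous_on ({a..b} \<times> {0..1} \<union> {a..b} \<times> {1..2}) (\<lambda>(t, r). ?u t r)"
    proof (rule continuous_on_closed_Un)
      have "continuous_on ({a..b} \<times> {0..1}) (\<lambda>p. (\<lambda>(t, r). uY t r) (121 * fst p, ?k (snd p)))"
        by (rule continuous_on_compose2[OF cY]) (use \<open>0 \<le> a\<close> in \<open>auto intro!: continuous_intros\<close>)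
      then show "continuous_on ({a..b} \<times> {0..1}) (\<lambda>(t, r). ?u t r)"
        by (rule continuous_on_eq) (use join0 \<open>0 \<le> a\<close> in \<open>auto simp: rescale_def\<close>)
      have "continuous_on ({a..b} \<times> {1..2}) (\<lambda>p. (\<lambda>(t, r). uW t r) (121 * fst p, ?k (snd p)))"
        by (rule continuous_on_compose2[OF cW]) (use \<open>0 \<le> a\<close> in \<open>auto intro!: continuous_intros\<close>)
      then show "continuous_on ({a..b} \<times> {1..2}) (\<lambda>(t, r). ?u t r)"
        by (rule continuous_on_eq) (auto simp: rescale_def)
    qed (auto intro!: closed_Times)
    moreover have "{a..b} \<times> {0..1} \<union> {a..b} \<times> {1..2} = {a..b} \<times> {0..(2::real)}" by auto
    ultimately show ?thesis by simp
  qed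
  have local: "(\<exists>v. \<forall>r\<in>{0<..<2} - {1}. (?u t has_real_derivative v r) (at r) \<and>
           (\<exists>D. ((\<lambda>x. x\<^sup>2 * v x) has_real_derivative D) (at r) \<and>
                ((\<lambda>s. ?u s r) has_real_derivative diffusivity r / r\<^sup>2 * D) (at t))) \<and>
        (\<exists>DY DW. (?u t has_real_derivative DY) (at 1 within {0..1}) \<and>
                 (?u t has_real_derivative DW) (at 1 within {1..2}) \<and> 17 * DY = 26 * DW) \<and>
        (\<exists>D. (?u t has_real_derivative D) (at 2 within {1..2}) \<and> 26 * D + 550 * (?u t 2 - B) = 0)"
    if t: "t \<in> {a<..<b}" for t
  proof (intro conjI)
    have t0: "0 < t" "0 < 121 * t" using t \<open>0 \<le> a\<close> by auto
    obtain vY where vY: "\<And>r. ?k r \<in> {0<..<0.011} \<Longrightarrow> ((\<lambda>r. uY (121 * t) (?k r)) has_real_derivative vY r) (at r)"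
      "\<And>r. ?k r \<in> {0<..<0.011} \<Longrightarrow> \<exists>D. ((\<lambda>x. x\<^sup>2 * vY x) has_real_derivative D) (at r) \<and>
        ((\<lambda>s. uY (121 * s) (?k r)) has_real_derivative 1000000 * (1.3 / 10 ^ 7) / r\<^sup>2 * D) (at t)"
      by (rule radial_heat_eq_rescale[OF eqY t0(1)]) blast
    obtain vW where vW: "\<And>r. ?k r \<in> {0.011<..<0.022} \<Longrightarrow> ((\<lambda>r. uW (121 * t) (?k r)) has_real_derivative vW r) (at r)"
      "\<And>r. ?k r \<in> {0.011<..<0.022} \<Longrightarrow> \<exists>D. ((\<lambda>x. x\<^sup>2 * vW x) has_real_derivative D) (at r) \<and>
        ((\<lambda>s. uW (121 * s) (?k r)) has_real_derivative 1000000 * (1.7 / 10 ^ 7) / r\<^sup>2 * D) (at t)"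
      by (rule radial_heat_eq_rescale[OF eqW t0(1)]) blast
    have yolk: "((\<lambda>r. if r < 1 then F r else G r) has_real_derivative D) (at r)"
      if "(F has_real_derivative D) (at r)" "r < 1" for F G :: "real \<Rightarrow> real" and D r
      by (rule has_field_derivative_transform_within_open[OF that(1), of "{..<1}"]) (use that in auto)
    have white: "((\<lambda>r. if r < 1 then F r else G r) has_real_derivative D) (at r)"
      if "(G has_real_derivative D) (at r)" "r > 1" for F G :: "real \<Rightarrow> real" and D r
      by (rule has_field_derivative_transform_within_open[OF that(1), of "{1<..}"]) (use that in auto)
    have if_sq: "(\<lambda>x. x\<^sup>2 * (if x < 1 then vY x else vW x)) = (\<lambda>x. if x < 1 then x\<^sup>2 * vY x else x\<^sup>2 * vW x)"
      by auto
    show "\<exists>v. \<forall>r\<in>{0<..<2} - {1}. (?u t has_real_derivative v r) (at r) \<and>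
           (\<exists>D. ((\<lambda>x. x\<^sup>2 * v x) has_real_derivative D) (at r) \<and>
                ((\<lambda>s. ?u s r) has_real_derivative diffusivity r / r\<^sup>2 * D) (at t))"
    proof (rule exI[of _ "\<lambda>r. if r < 1 then vY r else vW r"], intro ballI)
      fix r :: real assume r: "r \<in> {0<..<2} - {1}"
      show "(?u t has_real_derivative (if r < 1 then vY r else vW r)) (at r) \<and>
           (\<exists>D. ((\<lambda>x. x\<^sup>2 * (if x < 1 then vY x else vW x)) has_real_derivative D) (at r) \<and>
                ((\<lambda>s. ?u s r) has_real_derivative diffusivity r / r\<^sup>2 * D) (at t))"
      proof (cases "r < 1")
        case True
        then have kr: "?k r \<in> {0<..<0.011}" using r by auto
        obtain D where D: "((\<lambda>x. x\<^sup>2 * vY x) has_real_derivative D) (at r)"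
          "((\<lambda>s. uY (121 * s) (?k r)) has_real_derivative 1000000 * (1.3 / 10 ^ 7) / r\<^sup>2 * D) (at t)"
          using vY(2)[OF kr] by blast
        have "((\<lambda>s. ?u s r) has_real_derivative diffusivity r / r\<^sup>2 * D) (at t)"
          using D(2) True by (simp add: rescale_def diffusivity_def)
        moreover have "(?u t has_real_derivative vY r) (at r)"
          unfolding rescale_def by (rule yolk[OF vY(1)[OF kr] True])
        moreover have "((\<lambda>x. x\<^sup>2 * (if x < 1 then vY x else vW x)) has_real_derivative D) (at r)"
          unfolding if_sq by (rule yolk[OF D(1) True])
        ultimately show ?thesis using True by auto
      next
        case False
        then have kr: "?k r \<in> {0.011<..<0.022}" and r1: "1 < r" using r by auto
        obtain D where D: "((\<lambda>x. x\<^sup>2 * vW x) has_real_derivative D) (at r)"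
          "((\<lambda>s. uW (121 * s) (?k r)) has_real_derivative 1000000 * (1.7 / 10 ^ 7) / r\<^sup>2 * D) (at t)"
          using vW(2)[OF kr] by blast
        have "((\<lambda>s. ?u s r) has_real_derivative diffusivity r / r\<^sup>2 * D) (at t)"
          using D(2) False by (simp add: rescale_def diffusivity_def)
        moreover have "(?u t has_real_derivative vW r) (at r)"
          unfolding rescale_def by (rule white[OF vW(1)[OF kr] r1])
        moreover have "((\<lambda>x. x\<^sup>2 * (if x < 1 then vY x else vW x)) has_real_derivative D) (at r)"
          unfolding if_sq by (rule white[OF D(1) r1])
        ultimately show ?thesis using False by auto
      qed
    qed
    have onY: "?u t r = uY (121 * t) (?k r)" if "r \<in> {0..1}" for r
      using that join0[of "121 * t"] t0 by (auto simp: rescale_def)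
    have onW: "?u t r = uW (121 * t) (?k r)" if "r \<in> {1..2}" for r
      using that by (auto simp: rescale_def)
    obtain DY DW where flux': "(uY (121 * t) has_real_derivative DY) (at 0.011 within {0..0.011})"
        "(uW (121 * t) has_real_derivative DW) (at 0.011 within {0.011..0.022})" "0.34 * DY = 0.52 * DW"
      using flux[OF t0(2)] by blast
    show "\<exists>DY DW. (?u t has_real_derivative DY) (at 1 within {0..1}) \<and>
                 (?u t has_real_derivative DW) (at 1 within {1..2}) \<and> 17 * DY = 26 * DW"
    proof (intro exI conjI)
      show "(?u t has_real_derivative 11 / 1000 * DY) (at 1 within {0..1})"
        by (rule has_field_derivative_transform_within[OF rescale_within[of "uY (121 * t)"], where d = 1])
          (use onY flux'(1) in auto)
      show "(?u t has_real_derivative 11 / 1000 * DW) (at 1 within {1..2})"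
        by (rule has_field_derivative_transform_within[OF rescale_within[of "uW (121 * t)"], where d = 1])
          (use onW flux'(2) in auto)
      show "17 * (11 / 1000 * DY) = 26 * (11 / 1000 * DW)" using flux'(3) by simp
    qed
    obtain D where robin': "(uW (121 * t) has_real_derivative D) (at 0.022 within {0.011..0.022})"
        "- 0.52 * D = 1000 * (uW (121 * t) 0.022 - B)"
      using robin[OF t0(2)] phase[OF t] by auto
    show "\<exists>D. (?u t has_real_derivative D) (at 2 within {1..2}) \<and> 26 * D + 550 * (?u t 2 - B) = 0"
    proof (intro exI conjI)
      show "(?u t has_real_derivative 11 / 1000 * D) (at 2 within {1..2})"
        by (rule has_field_derivative_transform_within[OF rescale_within[of "uW (121 * t)"], where d = 1])
          (use onW robin'(1) in auto)
      show "26 * (11 / 1000 * D) + 550 * (?u t 2 - B) = 0" using robin'(2) onW[of 2] by simp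
    qed
  qed
  \<comment> \<open>Equalities may be multiplied by either sign, so one argument yields both halves
    of \<open>heat_sol\<close>.\<close>
  have "subsol a b (\<lambda>t r. \<sigma> * (?u t r - B))" for \<sigma>
    unfolding subsol_def
  proof (intro conjI ballI)
    have "continuous_on ({a..b} \<times> {0..2}) (\<lambda>p. \<sigma> * ((\<lambda>(t, r). ?u t r) p - B))"
      by (intro continuous_intros cont)
    then show "continuous_on ({a..b} \<times> {0..2}) (\<lambda>(t, r). \<sigma> * (?u t r - B))"
      by (simp add: case_prod_beta)
  next
    fix t assume t: "t \<in> {a<..<b}"
    have scale: "((\<lambda>x. \<sigma> * (f x - B)) has_real_derivative \<sigma> * D) (at x within X)"
      if "(f has_real_derivative D) (at x within X)" for f :: "real \<Rightarrow> real" and D x X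
      using that by (auto intro!: derivative_eq_intros)
    obtain v where v: "\<And>r. r \<in> {0<..<2} - {1} \<Longrightarrow> (?u t has_real_derivative v r) (at r) \<and>
           (\<exists>D. ((\<lambda>x. x\<^sup>2 * v x) has_real_derivative D) (at r) \<and>
                ((\<lambda>s. ?u s r) has_real_derivative diffusivity r / r\<^sup>2 * D) (at t))"
      using local[OF t] by blast
    show "\<exists>v. \<forall>r\<in>{0<..<2} - {1}. ((\<lambda>r. \<sigma> * (?u t r - B)) has_real_derivative v r) (at r) \<and>
           (\<exists>D E. ((\<lambda>x. x\<^sup>2 * v x) has_real_derivative D) (at r) \<and>
                  ((\<lambda>s. \<sigma> * (?u s r - B)) has_real_derivative E) (at t) \<and> E \<le> diffusivity r / r\<^sup>2 * D)"
    proof (rule exI[of _ "\<lambda>r. \<sigma> * v r"], intro ballI conjI)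
      fix r :: real assume r: "r \<in> {0<..<2} - {1}"
      show "((\<lambda>r. \<sigma> * (?u t r - B)) has_real_derivative \<sigma> * v r) (at r)"
        using v[OF r] by (intro scale) simp
      obtain D where D: "((\<lambda>x. x\<^sup>2 * v x) has_real_derivative D) (at r)"
          "((\<lambda>s. ?u s r) has_real_derivative diffusivity r / r\<^sup>2 * D) (at t)"
        using v[OF r] by blast
      show "\<exists>D E. ((\<lambda>x. x\<^sup>2 * (\<sigma> * v x)) has_real_derivative D) (at r) \<and>
                  ((\<lambda>s. \<sigma> * (?u s r - B)) has_real_derivative E) (at t) \<and> E \<le> diffusivity r / r\<^sup>2 * D"
        using DERIV_cmult[OF D(1), of \<sigma>] scale[OF D(2)]
        by (intro exI[of _ "\<sigma> * D"] exI[of _ "\<sigma> * (diffusivity r / r\<^sup>2 * D)"]) (simp add: mult.left_commute)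
    qed
    obtain DY DW where D: "(?u t has_real_derivative DY) (at 1 within {0..1})"
        "(?u t has_real_derivative DW) (at 1 within {1..2})" "17 * DY = 26 * DW"
      using local[OF t] by blast
    have "17 * (\<sigma> * DY) \<le> 26 * (\<sigma> * DW)" using D(3) by (simp add: mult.left_commute)
    then show "\<exists>DY DW. ((\<lambda>r. \<sigma> * (?u t r - B)) has_real_derivative DY) (at 1 within {0..1}) \<and>
                 ((\<lambda>r. \<sigma> * (?u t r - B)) has_real_derivative DW) (at 1 within {1..2}) \<and> 17 * DY \<le> 26 * DW"
      using scale[OF D(1)] scale[OF D(2)] by blast
    obtain D where D: "(?u t has_real_derivative D) (at 2 within {1..2})" "26 * D + 550 * (?u t 2 - B) = 0"
      using local[OF t] by blast
    have "26 * (\<sigma> * D) + 550 * (\<sigma> * (?u t 2 - B)) = \<sigma> * (26 * D + 550 * (?u t 2 - B))"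
      by (simp add: algebra_simps)
    then have "26 * (\<sigma> * D) + 550 * (\<sigma> * (?u t 2 - B)) \<le> 0" by (simp only: D(2) mult_zero_right order_refl)
    then show "\<exists>D. ((\<lambda>r. \<sigma> * (?u t r - B)) has_real_derivative D) (at 2 within {1..2}) \<and>
            26 * D + 550 * (\<sigma> * (?u t 2 - B)) \<le> 0"
      using scale[OF D(1)] by blast
  qed
  from this[of 1] this[of "- 1"] show ?thesis by (simp add: heat_sol_def)
qed

theorem proposition2:
  fixes L l rW \<alpha>Y \<alpha>W \<kappa>Y \<kappa>W h T0 TY TW Tice :: real
    and uY uW :: "real \<Rightarrow> real \<Rightarrow> real \<Rightarrow> real \<Rightarrow> real"
  assumes "L = 0.022" and "l = 0.011" and "rW = l + 3 / 4 * (L - l)"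
    and "\<alpha>Y = 1.3 / 10 ^ 7" and "\<alpha>W = 1.7 / 10 ^ 7"
    and "\<kappa>Y = 0.34" and "\<kappa>W = 0.52" and "h = 1000"
    and "T0 = 20" and "TY = 65" and "TW = 85" and "Tice = 1"
    and solution: "\<And>t1 t2. 0 \<le> t1 \<Longrightarrow> t1 < t2 \<Longrightarrow>
      egg_solution l L \<alpha>Y \<alpha>W \<kappa>Y \<kappa>W h T0 (bath TY Tice t1 t2) {t1, t2} (uY t1 t2) (uW t1 t2)"
  shows "\<exists>t1 t2 Ts. 0 < t1 \<and> t1 < t2 \<and> t2 \<le> Ts \<and>
    (\<exists>s. is_arg_max (\<lambda>t. uW t1 t2 t rW) (\<lambda>t. t2 \<le> t) s \<and> uW t1 t2 s rW = TW) \<and>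
    (is_arg_max (\<lambda>t. uY t1 t2 t 0) (\<lambda>t. t2 \<le> t) Ts \<and> uY t1 t2 Ts 0 = TY) \<and>
    ((\<forall>t\<in>{0..Ts}. uY t1 t2 t 0 \<le> TY) \<and> uY t1 t2 Ts 0 = TY) \<and>
    (\<forall>t\<in>{0..Ts}. uW t1 t2 t rW \<le> TW)"
proof -
  note params = assms(1-12)
  define v where "v t1 d = rescale (uY (121 * t1) (121 * (t1 + d))) (uW (121 * t1) (121 * (t1 + d)))" for t1 d
  have sol: "egg_solution 0.011 0.022 (1.3 / 10 ^ 7) (1.7 / 10 ^ 7) 0.34 0.52 1000 20
      (bath 65 1 (121 * t1) (121 * (t1 + d))) {121 * t1, 121 * (t1 + d)}
      (uY (121 * t1) (121 * (t1 + d))) (uW (121 * t1) (121 * (t1 + d)))" if "0 \<le> t1" "0 < d" for t1 d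
    using solution[of "121 * t1" "121 * (t1 + d)"] that unfolding params by simp
  interpret egg_family v
  proof
    fix t1 d r T :: real assume td: "0 \<le> t1" "0 < d"
    show "v t1 d 0 r = 20" if "r \<in> {0..2}"
      using sol[OF td] that unfolding egg_solution_def v_def rescale_def by auto
    show "heat_sol 0 t1 65 (v t1 d)" "heat_sol t1 (t1 + d) 100 (v t1 d)" "heat_sol (t1 + d) T 1 (v t1 d)"
      unfolding v_def using td by (intro heat_sol_rescale[OF sol[OF td]]; auto simp: bath_def)+
  qed
  obtain \<tau> d where \<tau>: "0 < \<tau>" and d: "0 < d" and W: "peak (7 / 4) \<tau> d = 85" and Y: "peak 0 \<tau> d = 65"
    by (rule targets_attained)
  define t1 t2 where "t1 = 121 * \<tau>" and "t2 = 121 * (\<tau> + d)"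
  have \<tau>0: "0 \<le> \<tau>" using \<tau> by simp
  have uY: "uY t1 t2 t 0 = v \<tau> d (t / 121) 0" and uW: "uW t1 t2 t rW = v \<tau> d (t / 121) (7 / 4)" for t
    by (simp_all add: v_def rescale_def t1_def t2_def params)
  have after: "v \<tau> d (t / 121) r = chilled \<tau> d ((t - t2) / 121) r" for t r
    by (simp add: chilled_def t2_def field_simps)
  \<comment> \<open>Before the chill the temperature rises to its value at \<open>t2\<close>, which
    is itself at most the peak. One bound thus serves both for maximality after \<open>t2\<close>
    and for the no-overshoot constraints.\<close>
  have le_peak: "v \<tau> d (t / 121) r \<le> peak r \<tau> d" if "0 \<le> t" "r \<in> {0..2}" for t r
  proof (cases "t2 \<le> t")
    case True
    then show ?thesis unfolding after using peak_upper[OF \<tau>0 d that(2)] by simp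
  next
    case False
    then have "v \<tau> d (t / 121) r \<le> chilled \<tau> d 0 r"
      using mono_until_chilled[OF \<tau>0 d, of "t / 121" r] that by (simp add: t2_def field_simps)
    then show ?thesis using peak_upper[OF \<tau>0 d that(2), of 0] by simp
  qed
  have t: "0 < t1" "t1 < t2" using \<tau> d by (simp_all add: t1_def t2_def)
  obtain sW where sW: "0 \<le> sW" "chilled \<tau> d sW (7 / 4) = 85" using peak_attained[OF \<tau>0 d, of "7 / 4"] W by auto
  obtain sY where sY: "0 \<le> sY" "chilled \<tau> d sY 0 = 65" using peak_attained[OF \<tau>0 d, of 0] Y by auto
  let ?tW = "t2 + 121 * sW" and ?Ts = "t2 + 121 * sY"
  have vW: "v \<tau> d (?tW / 121) (7 / 4) = 85" and vY: "v \<tau> d (?Ts / 121) 0 = 65"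
    unfolding after using sW sY by simp_all
  have leW: "v \<tau> d (t / 121) (7 / 4) \<le> 85" and leY: "v \<tau> d (t / 121) 0 \<le> 65" if "0 \<le> t" for t
    using le_peak[OF that, of "7 / 4"] le_peak[OF that, of 0] W Y by simp_all
  have targets: "TY = 65" "TW = 85" by (fact params)+
  show ?thesis
  proof (intro exI conjI)
    show "0 < t1" "t1 < t2" by (fact t)+
    show "t2 \<le> ?Ts" using sY by simp
    show "is_arg_max (\<lambda>t. uW t1 t2 t rW) (\<lambda>t. t2 \<le> t) ?tW"
      unfolding is_arg_max_linorder uW vW using leW t sW by auto
    show "uW t1 t2 ?tW rW = TW" unfolding uW vW targets ..
    show "is_arg_max (\<lambda>t. uY t1 t2 t 0) (\<lambda>t. t2 \<le> t) ?Ts"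
      unfolding is_arg_max_linorder uY vY using leY t sY by auto
    show "uY t1 t2 ?Ts 0 = TY" "uY t1 t2 ?Ts 0 = TY" unfolding uY vY targets by (rule refl)+
    show "\<forall>t\<in>{0..?Ts}. uY t1 t2 t 0 \<le> TY" unfolding uY targets using leY by simp
    show "\<forall>t\<in>{0..?Ts}. uW t1 t2 t rW \<le> TW" unfolding uW targets using leW by simp
  qed
qed

end
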